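(* Let $r\geq 1$, $m\geq 2$ and $q\geq 2$ be integers, and let $T_{r,m}$ be the Brown-Thompson group. Then: (A) If $\gcd(m-1,q)$ does not divide $r$, then there are $0$ conjugacy classes of elements of order $q$ in $T_{r,m}$. (B) If $\gcd(m-1,q)$ divides $r$, then for every integer $p$ coprime to $q$ there are exactly $\gcd(m-1,q)$ conjugacy classes in $T_{r,m}$ of elements of order $q$ and rotation number $\frac{p}{q}$ (mod $1$). (C) If $\gcd(m-1,q)$ divides $r$, then there are exactly $\varphi(q)\cdot\gcd(m-1,q)$ conjugacy classes of elements of order $q$ in $T_{r,m}$, where $\varphi$ is Euler's totient function.
   Context: For an integer $r\ge 1$, $\mathbb S_r=\mathbb R/r\mathbb Z$ is the circle of length $r$, and $\mathbb S^1=\mathbb S_1$. A homeomorphism $f$ of $\mathbb S_r$ is piecewise affine if there are a finite subdivision $0=a_0<a_1<\dots<a_p=r$ and a lift $\tilde f$ of $f$ to $\mathbb R$ such that $\tilde f(x)=\lambda_i x+\beta_i$ on each $[a_i,a_{i+1}]$, with $\lambda_i,\beta_i\in\mathbb R$. The $a_i$ are called the break points of $f$ (so the point $0=r$ of the circle always counts as a break point) and the $\lambda_i$ its slopes. $PL^+(\mathbb S_r)$ is the group of orientation-preserving piecewise affine homeomorphisms of $\mathbb S_r$. For integers $r\ge1$, $m\ge2$, put $\langle m\rangle=\{m^s: s\in\mathbb Z\}$ and $\mathbb Z[\frac1m]=\{N m^s: N,s\in\mathbb Z\}$. The Brown-Thompson group $T_{r,m}$ is the group of all $f\in PL^+(\mathbb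 S_r)$ whose slopes lie in $\langle m\rangle$, whose break points lie in $\mathbb Z[\frac1m]$, and such that the images under $f$ of its break points lie in $\mathbb Z[\frac1m]$ (modulo $r$). In particular $f(0)\in\mathbb Z[\frac1m]$ modulo $r$. The rotation number of an orientation-preserving homeomorphism $f$ of $\mathbb S_r$ is $\rho(f)=\lim_{n\to\infty}\frac{\tilde f^n(0)}{rn}\pmod 1\in\mathbb S^1$, where $\tilde f$ is any lift of $f$ to $\mathbb R$; it does not depend on the lift. *)

theory Defs
  imports
    "HOL-Analysis.Analysis"
    "HOL-Algebra.Bij"
    "HOL-Algebra.Group_Action"
    "HOL-Algebra.Multiplicative_Group"
    "HOL-Number_Theory.Totient"
begin

section \<open>The circle of length \<open>r\<close>\<close>

text \<open>Points of the circle are the cosets \<open>x + r\<int>\<close>.\<close>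

definition circle_pt :: "nat \<Rightarrow> real \<Rightarrow> real set" where
  "circle_pt r x = {x + real r * of_int k | k :: int. True}"

definition circle :: "nat \<Rightarrow> real set set" where
  "circle r = range (circle_pt r)"

definition circle_topology :: "nat \<Rightarrow> real set topology" where
  "circle_topology r = topology (\<lambda>U. U \<subseteq> circle r \<and> open (circle_pt r -` U))"

lemma openin_circle_topology:
  "openin (circle_topology r) U \<longleftrightarrow> U \<subseteq> circle r \<and> open (circle_pt r -` U)"
proof -
  have "istopology (\<lambda>U. U \<subseteq> circle r \<and> open (circle_pt r -` U))"
    by (auto simp: istopology_def vimage_Int vimage_Union)
  then show ?thesis
    by (simp add: circle_topology_def topology_inverse')
qed

lemma topspace_circle_topology [simp]: "topspace (circle_topology r) = circle r"
proof -
  have "openin (circle_topology r) (circle r)"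
    by (auto simp: openin_circle_topology circle_def vimage_def)
  then show ?thesis
    by (metis openin_circle_topology openin_subset openin_topspace subset_antisym)
qed

lemma quotient_map_circle_pt: "quotient_map euclidean (circle_topology r) (circle_pt r)"
  by (auto simp: quotient_map_def openin_circle_topology circle_def vimage_def)


section \<open>Piecewise affine homeomorphisms of the circle\<close>

definition is_lift :: "nat \<Rightarrow> (real set \<Rightarrow> real set) \<Rightarrow> (real \<Rightarrow> real) \<Rightarrow> bool" where
  "is_lift r f F \<longleftrightarrow>
     continuous_on UNIV F \<and> (\<forall>x. f (circle_pt r x) = circle_pt r (F x))"

text \<open>
  Maps of the circle are taken extensional, as in \<^const>\<open>BijGroup\<close>, so that equality of maps
  on the circle is equality in HOL.
\<close>

definition homeo_plus :: "nat \<Rightarrow> (real set \<Rightarrow> real set) set" where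
  "homeo_plus r =
     {f \<in> extensional (circle r).
        homeomorphic_map (circle_topology r) (circle_topology r) f \<and>
        (\<exists>F. is_lift r f F \<and> strict_mono F)}"

text \<open>
  The points \<open>a 0 < \<dots> < a p\<close> subdivide \<open>[0, r]\<close>, and \<open>F\<close> is affine with slope \<open>s i\<close> on
  \<open>[a i, a (i + 1)]\<close>. Only the values \<open>a i\<close> for \<open>i \<le> p\<close> and \<open>s i\<close> for \<open>i < p\<close> are relevant.
\<close>

definition affine_pieces ::
    "nat \<Rightarrow> (real \<Rightarrow> real) \<Rightarrow> nat \<Rightarrow> (nat \<Rightarrow> real) \<Rightarrow> (nat \<Rightarrow> real) \<Rightarrow> bool" where
  "affine_pieces r F p a s \<longleftrightarrow>
     a 0 = 0 \<and> a p = real r \<and>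
     (\<forall>i<p. a i < a (Suc i)) \<and>
     (\<forall>i<p. \<exists>b. \<forall>x\<in>{a i..a (Suc i)}. F x = s i * x + b)"

definition PL_plus :: "nat \<Rightarrow> (real set \<Rightarrow> real set) set" where
  "PL_plus r = {f \<in> homeo_plus r. \<exists>F p a s. is_lift r f F \<and> affine_pieces r F p a s}"


section \<open>Brown-Thompson groups\<close>

definition int_powers :: "nat \<Rightarrow> real set" where
  "int_powers m = {real m powi s | s :: int. True}"

definition Z_inv :: "nat \<Rightarrow> real set" where
  "Z_inv m = {of_int N * real m powi s | (N :: int) (s :: int). True}"

definition Brown_Thompson_set :: "nat \<Rightarrow> nat \<Rightarrow> (real set \<Rightarrow> real set) set" where
  "Brown_Thompson_set r m =
     {f \<in> PL_plus r. \<exists>F p a s. is_lift r f F \<and> affine_pieces r F p a s \<and>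
        (\<forall>i<p. s i \<in> int_powers m) \<and>
        (\<forall>i\<le>p. a i \<in> Z_inv m \<and> f (circle_pt r (a i)) \<in> circle_pt r ` Z_inv m)}"

definition Brown_Thompson :: "nat \<Rightarrow> nat \<Rightarrow> (real set \<Rightarrow> real set) monoid" where
  "Brown_Thompson r m = (BijGroup (circle r))\<lparr>carrier := Brown_Thompson_set r m\<rparr>"


section \<open>Rotation numbers\<close>

text \<open>The rotation number is a point of the circle of length \<open>1\<close>.\<close>

definition rotation_number :: "nat \<Rightarrow> (real set \<Rightarrow> real set) \<Rightarrow> real set" where
  "rotation_number r f =
     (let F = (SOME F. is_lift r f F)
      in circle_pt 1 (lim (\<lambda>n. (F ^^ n) 0 / (real r * real n))))"


section \<open>Conjugacy classes\<close>

text \<open>The classes of the elements of \<open>E\<close> under conjugation by all of \<open>G\<close>.\<close>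

definition conjugacy_classes :: "('a, 'b) monoid_scheme \<Rightarrow> 'a set \<Rightarrow> 'a set set" where
  "conjugacy_classes G E =
     orbits G E (\<lambda>g. \<lambda>h \<in> carrier G. g \<otimes>\<^bsub>G\<^esub> h \<otimes>\<^bsub>G\<^esub> inv\<^bsub>G\<^esub> g)"

definition elements_of_order :: "('a, 'b) monoid_scheme \<Rightarrow> nat \<Rightarrow> 'a set" where
  "elements_of_order G q = {x \<in> carrier G. group.ord G x = q}"

end

theory Submission
  imports Defs
begin

text \<open>
  An element of order \<open>q\<close> is a power \<open>g ^ p\<close> with \<open>p\<close> coprime to \<open>q\<close>, where \<open>g\<close> has a lift
  \<open>G\<close> whose \<open>q\<close>-th iterate is the translation by \<open>r\<close>; its rotation number is \<open>p / q\<close>. Slopes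
  are congruent to \<open>1\<close> modulo \<open>m - 1\<close> in \<open>\<int>[1/m]\<close>, so lifts preserve differences modulo
  \<open>m - 1\<close>; hence the class of \<open>G 0\<close> in \<open>\<int>[1/m] / (m - 1) = \<int> / (m - 1)\<close> is a conjugacy
  invariant \<open>b\<close>, and it satisfies \<open>q b = r\<close>. Conversely, two intervals with endpoints in
  \<open>\<int>[1/m]\<close> are piecewise affinely homeomorphic as soon as their lengths agree modulo \<open>m - 1\<close>.
  Extending such a homeomorphism equivariantly from a fundamental domain conjugates \<open>G\<close> to a
  translation of length congruent to \<open>b\<close>, so \<open>b\<close> determines \<open>g\<close> up to conjugacy, and every
  solution of \<open>q b = r\<close> modulo \<open>m - 1\<close> occurs. There are \<open>gcd (m - 1) q\<close> solutions if this
  number divides \<open>r\<close>, and none otherwise.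
\<close>

section \<open>Arithmetic modulo \<open>m - 1\<close> in \<open>\<int>[1/m]\<close>\<close>

locale m_adic =
  fixes m :: nat
  assumes m_ge_2: "m \<ge> 2"
begin

text \<open>Clearing denominators by a natural power of \<open>m\<close> reduces closure under sums
  and products to the ring structure of \<int>.\<close>

lemma Z_inv_iff: "x \<in> Z_inv m \<longleftrightarrow> (\<exists>k. x * real m ^ k \<in> \<int>)"
proof
  assume "x \<in> Z_inv m"
  then obtain N s where x: "x = of_int N * real m powi s"
    by (auto simp: Z_inv_def)
  have "real m powi s * real m ^ nat (- s) = real m ^ nat s"
    using m_ge_2 by (cases "s \<ge> 0") (auto simp: power_int_def field_simps)
  then have "x * real m ^ nat (- s) = of_int (N * int m ^ nat s)"
    by (simp add: x mult.assoc)
  then show "\<exists>k. x * real m ^ k \<in> \<int>"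
    by (metis Ints_of_int)
next
  assume "\<exists>k. x * real m ^ k \<in> \<int>"
  then obtain k N where "x * real m ^ k = of_int N"
    by (auto simp: Ints_def)
  then have "x = of_int N * real m powi (- int k)"
    using m_ge_2 by (simp add: power_int_minus field_simps)
  then show "x \<in> Z_inv m"
    by (auto simp: Z_inv_def)
qed

lemma Z_inv_of_int [simp]: "of_int n \<in> Z_inv m"
  by (auto simp: Z_inv_iff intro: exI[of _ 0])

lemma Z_inv_of_nat [simp]: "real n \<in> Z_inv m"
  using Z_inv_of_int[of "int n"] by simp

lemma Z_inv_0 [simp]: "0 \<in> Z_inv m"
  using Z_inv_of_int[of 0] by simp

lemma Z_inv_1 [simp]: "1 \<in> Z_inv m"
  using Z_inv_of_int[of 1] by simp

lemma Z_inv_add [simp, intro]: "x \<in> Z_inv m \<Longrightarrow> y \<in> Z_inv m \<Longrightarrow> x + y \<in> Z_inv m"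
proof -
  assume "x \<in> Z_inv m" "y \<in> Z_inv m"
  then obtain k l where "x * real m ^ k \<in> \<int>" "y * real m ^ l \<in> \<int>"
    by (auto simp: Z_inv_iff)
  then have "(x * real m ^ k) * real m ^ l + (y * real m ^ l) * real m ^ k \<in> \<int>"
    by (metis Ints_add Ints_mult Ints_power Ints_of_nat)
  then have "(x + y) * real m ^ (k + l) \<in> \<int>"
    by (simp add: power_add algebra_simps)
  then show ?thesis
    unfolding Z_inv_iff by blast
qed

lemma Z_inv_mult [simp, intro]: "x \<in> Z_inv m \<Longrightarrow> y \<in> Z_inv m \<Longrightarrow> x * y \<in> Z_inv m"
proof -
  assume "x \<in> Z_inv m" "y \<in> Z_inv m"
  then obtain k l where "x * real m ^ k \<in> \<int>" "y * real m ^ l \<in> \<int>"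
    by (auto simp: Z_inv_iff)
  then have "(x * real m ^ k) * (y * real m ^ l) \<in> \<int>"
    by (rule Ints_mult)
  then have "(x * y) * real m ^ (k + l) \<in> \<int>"
    by (simp add: power_add algebra_simps)
  then show ?thesis
    unfolding Z_inv_iff by blast
qed

lemma Z_inv_minus [simp, intro]: "x \<in> Z_inv m \<Longrightarrow> - x \<in> Z_inv m"
  using Z_inv_mult[of "-1" x] Z_inv_of_int[of "-1"] by simp

lemma Z_inv_diff [simp, intro]: "x \<in> Z_inv m \<Longrightarrow> y \<in> Z_inv m \<Longrightarrow> x - y \<in> Z_inv m"
  using Z_inv_add[of x "- y"] by simp

lemma int_powers_pos: "s \<in> int_powers m \<Longrightarrow> s > 0"
  using m_ge_2 by (auto simp: int_powers_def)

lemma one_in_int_powers [simp]: "1 \<in> int_powers m"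
  unfolding int_powers_def by (auto intro: exI[of _ 0])

lemma int_powers_power [simp]: "real m ^ k \<in> int_powers m"
  unfolding int_powers_def by (auto intro: exI[of _ "int k"])

lemma int_powers_mult [intro]: "s \<in> int_powers m \<Longrightarrow> t \<in> int_powers m \<Longrightarrow> s * t \<in> int_powers m"
  using m_ge_2 unfolding int_powers_def
  by clarsimp (metis power_int_add of_nat_0_eq_iff not_numeral_le_zero)

lemma int_powers_inverse [intro]: "s \<in> int_powers m \<Longrightarrow> 1 / s \<in> int_powers m"
  unfolding int_powers_def
  by clarsimp (metis power_int_minus inverse_eq_divide)

lemma int_powers_Z_inv [intro]: "s \<in> int_powers m \<Longrightarrow> s \<in> Z_inv m"
  unfolding int_powers_def Z_inv_def
  by clarsimp (metis of_int_1 mult_1)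

text \<open>Congruence modulo the ideal (m - 1) \<int>[1/m]. Only the difference is constrained;
  \<open>x\<close> and \<open>y\<close> may be any reals.\<close>

definition zcong :: "real \<Rightarrow> real \<Rightarrow> bool" where
  "zcong x y \<longleftrightarrow> (\<exists>z\<in>Z_inv m. x - y = (real m - 1) * z)"

lemma zcong_refl [simp]: "zcong x x"
  unfolding zcong_def by (auto intro: bexI[of _ 0])

lemma zcong_sym: "zcong x y \<Longrightarrow> zcong y x"
proof -
  assume "zcong x y"
  then obtain z where "z \<in> Z_inv m" "x - y = (real m - 1) * z"
    by (auto simp: zcong_def)
  then have "- z \<in> Z_inv m" "y - x = (real m - 1) * (- z)"
    by (auto simp: algebra_simps)
  then show ?thesis
    unfolding zcong_def by blast
qed

lemma zcong_add: "zcong x y \<Longrightarrow> zcong u v \<Longrightarrow> zcong (x + u) (y + v)"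
proof -
  assume "zcong x y" "zcong u v"
  then obtain z w where "z \<in> Z_inv m" "x - y = (real m - 1) * z"
      "w \<in> Z_inv m" "u - v = (real m - 1) * w"
    by (auto simp: zcong_def)
  then have "z + w \<in> Z_inv m" "(x + u) - (y + v) = (real m - 1) * (z + w)"
    by (auto simp: algebra_simps)
  then show ?thesis
    unfolding zcong_def by blast
qed

lemma zcong_trans [trans]: "zcong x y \<Longrightarrow> zcong y z \<Longrightarrow> zcong x z"
  using zcong_add[of x y y z] by (simp add: zcong_def)

lemma zcong_mult: "a \<in> Z_inv m \<Longrightarrow> zcong x y \<Longrightarrow> zcong (a * x) (a * y)"
proof -
  assume a: "a \<in> Z_inv m" and "zcong x y"
  then obtain z where "z \<in> Z_inv m" "x - y = (real m - 1) * z"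
    by (auto simp: zcong_def)
  with a have "a * z \<in> Z_inv m" "a * x - a * y = (real m - 1) * (a * z)"
    by (auto simp flip: right_diff_distrib)
  then show ?thesis
    unfolding zcong_def by blast
qed

lemma zcong_power_1: "zcong (real m ^ k) 1"
proof (induction k)
  case (Suc k)
  have "zcong (real m * real m ^ k) (real m * 1)"
    by (intro zcong_mult Suc) auto
  also have "zcong (real m * 1) 1"
    unfolding zcong_def by (auto intro: bexI[of _ 1])
  finally show ?case by simp
qed simp

text \<open>If \<open>s\<close> is a negative power of \<open>m\<close>, its inverse is a natural
  power and so congruent to 1; multiplying that congruence by \<open>s\<close> gives the
  claim.\<close>

lemma zcong_int_powers_1: "s \<in> int_powers m \<Longrightarrow> zcong s 1"
proof -
  assume s: "s \<in> int_powers m"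
  then obtain i where i: "s = real m powi i"
    by (auto simp: int_powers_def)
  show ?thesis
  proof (cases "i \<ge> 0")
    case True
    then show ?thesis
      using zcong_power_1 by (simp add: i power_int_def)
  next
    case False
    then have "s * real m ^ nat (- i) = 1"
      using m_ge_2 by (simp add: i power_int_def field_simps)
    moreover have "zcong (s * real m ^ nat (- i)) (s * 1)"
      using s by (intro zcong_mult zcong_power_1) auto
    ultimately show ?thesis
      using zcong_sym by simp
  qed
qed

lemma zcong_int_powers_mult:
  assumes "s \<in> int_powers m" "x \<in> Z_inv m"
  shows "zcong (s * x) x"
  using zcong_mult[OF assms(2) zcong_int_powers_1[OF assms(1)]] by (simp add: mult.commute)

text \<open>The denominator \<open>m ^ k\<close> is coprime to m - 1, so it can be cancelled.
  Together with \<open>zcong_of_int_ex\<close> this identifies \<int>[1/m] / (m - 1) with \<int> /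
  (m - 1).\<close>

lemma zcong_of_int_iff: "zcong (of_int a) (of_int b) \<longleftrightarrow> int (m - 1) dvd a - b"
proof
  assume "zcong (of_int a) (of_int b)"
  then obtain z where z: "z \<in> Z_inv m" "of_int a - of_int b = (real m - 1) * z"
    by (auto simp: zcong_def)
  then obtain k N where k: "z * real m ^ k = of_int N"
    by (auto simp: Z_inv_iff Ints_def)
  have "of_int ((a - b) * int m ^ k) = (of_int ((int m - 1) * N) :: real)"
    using z(2) k by simp
  then have "(a - b) * int m ^ k = (int m - 1) * N"
    by linarith
  moreover have "coprime (int m - 1) (int m ^ k)"
    by (simp add: coprime_diff_one_left)
  ultimately have "int m - 1 dvd a - b"
    by (metis coprime_dvd_mult_left_iff dvd_triv_left)
  then show "int (m - 1) dvd a - b"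
    using m_ge_2 by (simp add: of_nat_diff)
next
  assume "int (m - 1) dvd a - b"
  then obtain c where "a - b = (int m - 1) * c"
    using m_ge_2 by (auto simp: of_nat_diff)
  then have "of_int (a - b) = (real m - 1) * of_int c"
    by simp
  then show "zcong (of_int a) (of_int b)"
    unfolding zcong_def by (metis Z_inv_of_int of_int_diff)
qed

lemma zcong_of_int_ex:
  assumes "x \<in> Z_inv m"
  shows "\<exists>n. zcong x (of_int n)"
proof -
  obtain N s where "x = real m powi s * of_int N"
    using assms by (auto simp: Z_inv_def mult.commute)
  then show ?thesis
    using zcong_int_powers_mult[of "real m powi s" "of_int N"]
    by (auto simp: int_powers_def)
qed

section \<open>Piecewise affine maps of an interval\<close>

text \<open>\<open>plm F a b\<close>: on the interval from \<open>a\<close> to \<open>b\<close>, both in \<open>\<int>[1/m]\<close>, the function \<open>F\<close> is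
  continuous and piecewise affine, with slopes powers of \<open>m\<close> and breaks and their images in
  \<open>\<int>[1/m]\<close>.\<close>

inductive plm :: "(real \<Rightarrow> real) \<Rightarrow> real \<Rightarrow> real \<Rightarrow> bool" for F a where
  refl: "a \<in> Z_inv m \<Longrightarrow> F a \<in> Z_inv m \<Longrightarrow> plm F a a"
| step: "plm F a b \<Longrightarrow> b < c \<Longrightarrow> c \<in> Z_inv m \<Longrightarrow> s \<in> int_powers m \<Longrightarrow>
    (\<And>x. b \<le> x \<Longrightarrow> x \<le> c \<Longrightarrow> F x = F b + s * (x - b)) \<Longrightarrow> plm F a c"

lemma plm_le: "plm F a b \<Longrightarrow> a \<le> b"
proof (induction rule: plm.induct)
  case (step b c s)
  show ?case using step.IH step.hyps(2) by simp
qed simp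

lemma plm_Z_inv_all:
  "plm F a b \<Longrightarrow> a \<in> Z_inv m \<and> b \<in> Z_inv m \<and> F a \<in> Z_inv m \<and> F b \<in> Z_inv m"
proof (induction rule: plm.induct)
  case (step b c s)
  have "F c = F b + s * (c - b)"
    using step.hyps(2) step.hyps(5)[of c] by simp
  moreover have "F b + s * (c - b) \<in> Z_inv m"
    using step.hyps(2-4) step.IH by (auto intro!: Z_inv_add Z_inv_mult Z_inv_diff)
  ultimately show ?case
    using step.hyps(3) step.IH by simp
qed simp

lemmas plm_Z_inv = plm_Z_inv_all[THEN conjunct1] plm_Z_inv_all[THEN conjunct2, THEN conjunct1]
  plm_Z_inv_all[THEN conjunct2, THEN conjunct2, THEN conjunct1]
  plm_Z_inv_all[THEN conjunct2, THEN conjunct2, THEN conjunct2]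

lemma plm_affine:
  assumes "a \<in> Z_inv m" "b \<in> Z_inv m" "F a \<in> Z_inv m" "a \<le> b" "s \<in> int_powers m"
    and "\<And>x. a \<le> x \<Longrightarrow> x \<le> b \<Longrightarrow> F x = F a + s * (x - a)"
  shows "plm F a b"
proof (cases "a = b")
  case False
  show ?thesis
    by (rule plm.step[OF plm.refl, where s = s]) ((rule assms(6); assumption) | use False assms(1-5) in force)+
qed (use assms(1,3) in \<open>auto intro: plm.refl\<close>)

lemma plm_trans: "plm F b c \<Longrightarrow> plm F a b \<Longrightarrow> plm F a c"
proof (induction rule: plm.induct)
  case (step c d s)
  show ?case
    by (rule plm.step[OF step.IH[OF step.prems] step.hyps(2-5)])
qed

lemma plm_cong:
  "plm F a b \<Longrightarrow> (\<And>x. a \<le> x \<Longrightarrow> x \<le> b \<Longrightarrow> F x = G x) \<Longrightarrow> plm G a b"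
proof (induction rule: plm.induct)
  case (step b c s)
  have *: "F x = G x" if "a \<le> x" "x \<le> c" for x
    using that step.prems by auto
  have "a \<le> b"
    using step.hyps(1) by (rule plm_le)
  have "plm G a b"
    using step.hyps(2) by (intro step.IH *) auto
  then show ?case
  proof (rule plm.step)
    show "G x = G b + s * (x - b)" if "b \<le> x" "x \<le> c" for x
      using step.hyps(2) step.hyps(5)[of x] that \<open>a \<le> b\<close> by (simp flip: *)
  qed (use step.hyps(2-4) in auto)
qed (auto intro: plm.refl)

lemma plm_split:
  "plm F a b \<Longrightarrow> d \<in> Z_inv m \<Longrightarrow> a \<le> d \<Longrightarrow> d \<le> b \<Longrightarrow> plm F a d \<and> plm F d b"
proof (induction rule: plm.induct)
  case (step b c s)
  show ?case
  proof (cases "d \<le> b")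
    case True
    then have "plm F a d" "plm F d b"
      using step.IH step.prems by auto
    then show ?thesis
      using plm.step[OF \<open>plm F d b\<close> step.hyps(2-5)] by blast
  next
    case False
    have Fb: "F b \<in> Z_inv m"
      using plm_Z_inv[OF step.hyps(1)] by auto
    have bz: "b \<in> Z_inv m"
      using plm_Z_inv[OF step.hyps(1)] by auto
    have Fd: "F d = F b + s * (d - b)"
      using False step.prems step.hyps(5)[of d] by auto
    have "plm F a d"
    proof (rule plm.step[OF step.hyps(1)])
      show "F x = F b + s * (x - b)" if "b \<le> x" "x \<le> d" for x
        using that step.prems step.hyps(5)[of x] by auto
    qed (use False step.prems step.hyps(4) in auto)
    moreover have "plm F d c"
    proof (rule plm_affine)
      show "F d \<in> Z_inv m"
        unfolding Fd using Fb bz step.hyps(2-4) step.prems by auto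
      show "F x = F d + s * (x - d)" if "d \<le> x" "x \<le> c" for x
        using step.hyps(5)[of x] that False by (simp add: Fd algebra_simps)
    qed (use step.hyps(2-4) step.prems in auto)
    ultimately show ?thesis ..
  qed
qed (auto intro: plm.refl)

lemma plm_restrict:
  assumes "plm F a b" "c \<in> Z_inv m" "d \<in> Z_inv m" "a \<le> c" "c \<le> d" "d \<le> b"
  shows "plm F c d"
  using plm_split[of F a b d] plm_split[of F a d c] assms by auto

lemma plm_strict_mono: "plm F a b \<Longrightarrow> a \<le> x \<Longrightarrow> x < y \<Longrightarrow> y \<le> b \<Longrightarrow> F x < F y"
proof (induction arbitrary: x y rule: plm.induct)
  case (step b c s)
  have aff: "F x < F y" if "b \<le> x" "x < y" "y \<le> c" for x y
    using that step.hyps(5)[of x] step.hyps(5)[of y] int_powers_pos[OF step.hyps(4)] by simp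
  consider "y \<le> b" | "x < b" "b < y" | "b \<le> x" by linarith
  then show ?case
  proof cases
    case 2
    then have "F x < F b" "F b < F y"
      using step.IH[of x b] aff[of b y] step.prems by auto
    then show ?thesis by simp
  qed (use step.prems aff step.IH in blast)+
qed auto

lemma plm_image: "plm F a b \<Longrightarrow> F a \<le> y \<Longrightarrow> y \<le> F b \<Longrightarrow> \<exists>x. a \<le> x \<and> x \<le> b \<and> F x = y"
proof (induction rule: plm.induct)
  case (step b c s)
  show ?case
  proof (cases "y \<le> F b")
    case True
    then show ?thesis
      using step.hyps(2) step.IH step.prems by fastforce
  next
    case False
    have s: "s > 0"
      using int_powers_pos step.hyps(4) by auto
    have Fc: "F c = F b + s * (c - b)"
      using step.hyps(2) step.hyps(5)[of c] by auto
    define x where "x = b + (y - F b) / s"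
    have x: "b \<le> x" "x \<le> c"
      using False s step.prems Fc by (auto simp: x_def field_simps)
    have "F x = y"
      using step.hyps(5)[OF x] s by (simp add: x_def)
    with x plm_le[OF step.hyps(1)] show ?thesis by (intro exI[of _ x]) auto
  qed
qed auto

lemma plm_mono: "plm F a b \<Longrightarrow> a \<le> x \<Longrightarrow> x \<le> y \<Longrightarrow> y \<le> b \<Longrightarrow> F x \<le> F y"
  using plm_strict_mono[of F a b x y] by (cases "x = y") auto

text \<open>The increment over a piece is its length times a power of \<open>m\<close>, hence
  congruent to its length, and increments add up. This is the obstruction to mapping one interval
  onto another.\<close>

lemma plm_zcong: "plm F a b \<Longrightarrow> zcong (F b - F a) (b - a)"
proof (induction rule: plm.induct)
  case (step b c s)
  have Fc: "F c - F b = s * (c - b)"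
    using step.hyps(2) step.hyps(5)[of c] by auto
  have "zcong (F c - F b) (c - b)"
    unfolding Fc using step.hyps(2-4) plm_Z_inv[OF step.hyps(1)] by (intro zcong_int_powers_mult) auto
  from zcong_add[OF this step.IH] show ?case by simp
qed auto

text \<open>A break \<open>w\<close> of \<open>G\<close> is pulled back to
  \<open>b + (w - u) / s\<close> and slopes are multiplied. This settles a single piece of the inner
  map in \<open>plm_comp\<close>.\<close>

lemma plm_comp_affine:
  "plm G u v \<Longrightarrow> s \<in> int_powers m \<Longrightarrow> b \<in> Z_inv m \<Longrightarrow>
    plm (\<lambda>x. G (u + s * (x - b))) b (b + (v - u) / s)"
proof (induction rule: plm.induct)
  case refl
  then show ?case by (auto intro: plm.refl)
next
  case (step v w t)
  have s: "s > 0" "1 / s \<in> Z_inv m"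
    using int_powers_pos step.prems by auto
  show ?case
  proof (rule plm.step)
    show "plm (\<lambda>x. G (u + s * (x - b))) b (b + (v - u) / s)"
      using step.IH step.prems by auto
    show "b + (v - u) / s < b + (w - u) / s"
      using s step.hyps(2) by (simp add: divide_strict_right_mono)
    have "b + (1 / s) * (w - u) \<in> Z_inv m"
      using s step.hyps(3) step.prems plm_Z_inv[OF step.hyps(1)] by (intro Z_inv_add Z_inv_mult Z_inv_diff) auto
    then show "b + (w - u) / s \<in> Z_inv m" by simp
    show "t * s \<in> int_powers m"
      using step.hyps(4) step.prems by auto
    fix x assume x: "b + (v - u) / s \<le> x" "x \<le> b + (w - u) / s"
    have "v \<le> u + s * (x - b)" "u + s * (x - b) \<le> w"
      using x s by (auto simp: field_simps)
    then have "G (u + s * (x - b)) = G v + t * (u + s * (x - b) - v)"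
      by (rule step.hyps(5))
    moreover have "u + s * (b + (v - u) / s - b) = v"
        "t * s * (x - (b + (v - u) / s)) = t * (u + s * (x - b) - v)"
      using s by (simp_all add: field_simps)
    ultimately show "G (u + s * (x - b)) =
        G (u + s * (b + (v - u) / s - b)) + t * s * (x - (b + (v - u) / s))"
      by (simp only:)
  qed
qed

text \<open>Induction over the pieces of the inner map: cutting \<open>G\<close> at
  \<open>F b\<close> leaves an affine inner map on the last piece.\<close>

lemma plm_comp:
  "plm F a b \<Longrightarrow> plm G (F a) (F b) \<Longrightarrow> plm (\<lambda>x. G (F x)) a b"
proof (induction rule: plm.induct)
  case refl
  then show ?case
    using plm_Z_inv by (auto intro: plm.refl)
next
  case (step b c s)
  have F_ac: "plm F a c"
    using step.hyps by (rule plm.step)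
  have s: "s > 0"
    using int_powers_pos step.hyps(4) by auto
  have "F a \<le> F b" "F b \<le> F c"
    using plm_mono[OF F_ac] plm_le[OF step.hyps(1)] step.hyps(2) by auto
  moreover have Fb: "b \<in> Z_inv m" "F b \<in> Z_inv m"
    using plm_Z_inv[OF step.hyps(1)] by auto
  ultimately have 1: "plm G (F a) (F b)" and 2: "plm G (F b) (F c)"
    using plm_split[OF step.prems, of "F b"] by auto
  have "F c = F b + s * (c - b)"
    using step.hyps(2) step.hyps(5)[of c] by auto
  then have c: "b + (F c - F b) / s = c"
    using s by simp
  have "plm (\<lambda>x. G (F b + s * (x - b))) b c"
    using plm_comp_affine[OF 2 step.hyps(4) Fb(1)] unfolding c .
  then have "plm (\<lambda>x. G (F x)) b c"
    by (rule plm_cong) (subst step.hyps(5), auto)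
  from plm_trans[OF this step.IH[OF 1]] show ?case .
qed

text \<open>A piece of slope \<open>s\<close> inverts to one of slope \<open>1 / s\<close>. A left
  inverse is enough because each point between \<open>F b\<close> and \<open>F c\<close> is written
  explicitly as a value of \<open>F\<close>.\<close>

lemma plm_inverse:
  "plm F a b \<Longrightarrow> (\<And>x. a \<le> x \<Longrightarrow> x \<le> b \<Longrightarrow> G (F x) = x) \<Longrightarrow> plm G (F a) (F b)"
proof (induction rule: plm.induct)
  case refl
  then show ?case by (simp add: plm.refl)
next
  case (step b c s)
  have s: "s > 0"
    using int_powers_pos step.hyps(4) by auto
  have F_ac: "plm F a c"
    using step.hyps by (rule plm.step)
  have Fc: "F c = F b + s * (c - b)"
    using step.hyps(2) step.hyps(5)[of c] by auto
  show ?case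
  proof (rule plm.step)
    show "plm G (F a) (F b)"
      using step.hyps(2) step.IH step.prems by auto
    show "F b < F c"
      using plm_strict_mono[OF F_ac] plm_le[OF step.hyps(1)] step.hyps(2) by auto
    show "F c \<in> Z_inv m"
      using plm_Z_inv[OF F_ac] by auto
    show "1 / s \<in> int_powers m"
      using step.hyps(4) by auto
    fix y assume y: "F b \<le> y" "y \<le> F c"
    define x where "x = b + (y - F b) / s"
    have x: "b \<le> x" "x \<le> c"
      using s y Fc by (auto simp: x_def field_simps)
    have "F x = y"
      using step.hyps(5)[OF x] s by (simp add: x_def)
    moreover have "G (F x) = x" "G (F b) = b"
      using step.prems[of x] step.prems[of b] x plm_le[OF step.hyps(1)] step.hyps(2) by auto
    ultimately show "G y = G (F b) + 1 / s * (y - F b)"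
      by (simp add: x_def)
  qed
qed

section \<open>Lengths of piecewise affinely homeomorphic intervals\<close>

definition plm_equiv :: "real \<Rightarrow> real \<Rightarrow> bool" where
  "plm_equiv x y \<longleftrightarrow> (\<exists>h. plm h 0 x \<and> h 0 = 0 \<and> h x = y)"

lemma plm_equiv_trans [trans]: "plm_equiv x y \<Longrightarrow> plm_equiv y z \<Longrightarrow> plm_equiv x z"
proof -
  assume "plm_equiv x y" "plm_equiv y z"
  then obtain h k where *: "plm h 0 x" "h 0 = 0" "h x = y" "plm k 0 y" "k 0 = 0" "k y = z"
    unfolding plm_equiv_def by blast
  then have "plm (\<lambda>t. k (h t)) 0 x"
    using plm_comp[of h 0 x k] by simp
  with * show ?thesis
    unfolding plm_equiv_def by (intro exI[of _ "\<lambda>t. k (h t)"]) simp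
qed

lemma plm_equiv_sym: "plm_equiv x y \<Longrightarrow> plm_equiv y x"
proof -
  assume "plm_equiv x y"
  then obtain h where h: "plm h 0 x" "h 0 = 0" "h x = y"
    unfolding plm_equiv_def by blast
  define g where "g = inv_into {0..x} h"
  have "inj_on h {0..x}"
  proof (rule inj_onI)
    fix u v assume "u \<in> {0..x}" "v \<in> {0..x}" "h u = h v"
    then show "u = v"
      using plm_strict_mono[OF h(1), of u v] plm_strict_mono[OF h(1), of v u] by fastforce
  qed
  then have g: "g (h t) = t" if "0 \<le> t" "t \<le> x" for t
    using that by (simp add: g_def inv_into_f_f)
  have "plm g 0 y"
    using plm_inverse[OF h(1), of g] g h by simp
  moreover have "g 0 = 0" "g y = x"
    using g[of 0] g[of x] h plm_le[OF h(1)] by auto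
  ultimately show ?thesis
    unfolding plm_equiv_def by blast
qed

lemma plm_equiv_scale: "x \<in> Z_inv m \<Longrightarrow> x \<ge> 0 \<Longrightarrow> plm_equiv x (real m ^ k * x)"
  unfolding plm_equiv_def
  by (intro exI[of _ "\<lambda>t. real m ^ k * t"]) (auto intro!: plm_affine[of _ _ _ "real m ^ k"])

text \<open>Stretching the first unit interval by the factor \<open>m\<close> and translating the
  rest adds m - 1 to the length.\<close>

lemma plm_equiv_add_step: "n \<ge> 1 \<Longrightarrow> plm_equiv (real n) (real n + (real m - 1))"
proof -
  assume n: "n \<ge> 1"
  define h where "h = (\<lambda>t. if t \<le> 1 then real m * t else t + (real m - 1))"
  have "plm h 0 1"
    using int_powers_power[of 1] by (intro plm_affine[where s = "real m"]) (auto simp: h_def)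
  moreover have "plm h 1 (real n)"
    using n by (intro plm_affine[where s = 1]) (auto simp: h_def)
  ultimately have "plm h 0 (real n)"
    using plm_trans by blast
  moreover have "h 0 = 0" "h (real n) = real n + (real m - 1)"
    using n by (auto simp: h_def)
  ultimately show ?thesis
    unfolding plm_equiv_def by blast
qed

lemma plm_equiv_of_nat: "n \<ge> 1 \<Longrightarrow> plm_equiv (real n) (real n + real k * (real m - 1))"
proof (induction k)
  case 0
  \<comment> \<open>Scaling by the zeroth power of \<open>m\<close> serves as reflexivity.\<close>
  then show ?case
    using plm_equiv_scale[of "real n" 0] by simp
next
  case (Suc k)
  have eq: "real (n + k * (m - 1)) = real n + real k * (real m - 1)"
    using m_ge_2 by (simp add: of_nat_diff)
  have "plm_equiv (real n) (real (n + k * (m - 1)))"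
    unfolding eq using Suc by simp
  also have "plm_equiv (real (n + k * (m - 1))) (real (n + k * (m - 1)) + (real m - 1))"
    using Suc by (intro plm_equiv_add_step) auto
  finally show ?case
    unfolding eq by (simp add: algebra_simps)
qed

text \<open>Converse of the obstruction: a common power of \<open>m\<close> scales both lengths to
  positive integers, still congruent, and the smaller one is lengthened in steps of m - 1.\<close>

lemma plm_equiv_if_zcong:
  assumes "x \<in> Z_inv m" "y \<in> Z_inv m" "0 < x" "0 < y" "zcong x y"
  shows "plm_equiv x y"
proof -
  obtain k l where "x * real m ^ k \<in> \<int>" "y * real m ^ l \<in> \<int>"
    using assms by (auto simp: Z_inv_iff)
  then have "real m ^ l * (x * real m ^ k) \<in> \<int>" "real m ^ k * (y * real m ^ l) \<in> \<int>"
    by (metis Ints_mult Ints_power Ints_of_nat)+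
  then obtain a' b' where a': "real m ^ (k + l) * x = of_int a'" and b': "real m ^ (k + l) * y = of_int b'"
    by (auto simp: Ints_def power_add algebra_simps)
  have "of_int a' > (0::real)" "of_int b' > (0::real)"
    using assms m_ge_2 by (auto simp flip: a' b')
  then have pos: "a' > 0" "b' > 0"
    by auto
  define a b where "a = nat a'" and "b = nat b'"
  have ab: "real m ^ (k + l) * x = real a" "real m ^ (k + l) * y = real b" "a \<ge> 1" "b \<ge> 1"
    using pos by (auto simp: a_def b_def a' b')
  have "zcong (real a) (real b)"
    unfolding ab(1,2)[symmetric] using assms by (intro zcong_mult) auto
  then have dvd: "int (m - 1) dvd int a - int b"
    using zcong_of_int_iff[of "int a" "int b"] by simp
  \<comment> \<open>The construction only lengthens, so the smaller integer comes first; symmetry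
    covers the other order.\<close>
  have key: "plm_equiv (real a) (real b)" if "a \<le> b" "int (m - 1) dvd int b - int a" "a \<ge> 1" for a b
  proof -
    have "m - 1 dvd b - a"
      using that by (metis of_nat_diff of_nat_dvd_iff)
    then obtain j where "b - a = (m - 1) * j" ..
    then have "b = a + j * (m - 1)"
      using that(1) by (simp add: mult.commute)
    then show ?thesis
      using plm_equiv_of_nat[OF that(3), of j] m_ge_2 by (simp add: of_nat_diff)
  qed
  have "plm_equiv (real a) (real b)"
  proof (cases "a \<le> b")
    case True
    then show ?thesis
      using key[of a b] dvd ab by (simp add: dvd_diff_commute)
  next
    case False
    then show ?thesis
      using key[of b a] dvd ab by (simp add: plm_equiv_sym)
  qed
  moreover have "plm_equiv x (real a)" "plm_equiv y (real b)"
    using plm_equiv_scale[of x "k + l"] plm_equiv_scale[of y "k + l"] assms ab by auto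
  ultimately show ?thesis
    using plm_equiv_trans plm_equiv_sym by blast
qed

section \<open>Piecewise affine homeomorphisms of the line\<close>

text \<open>Requiring \<open>plm\<close> on all bounded intervals allows infinitely many breaks, but
  only locally finitely many. Surjectivity is a separate condition because slopes may decay so fast
  that the image is bounded.\<close>

definition PLM :: "(real \<Rightarrow> real) set" where
  "PLM = {F. surj F \<and> (\<forall>a\<in>Z_inv m. \<forall>b\<in>Z_inv m. a \<le> b \<longrightarrow> plm F a b)}"

lemma PLM_plm: "F \<in> PLM \<Longrightarrow> a \<in> Z_inv m \<Longrightarrow> b \<in> Z_inv m \<Longrightarrow> a \<le> b \<Longrightarrow> plm F a b"
  by (auto simp: PLM_def)

text \<open>The windows exhaust the domain and the range: restriction gives \<open>plm\<close> on
  every interval, and \<open>plm_image\<close> gives surjectivity.\<close>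

lemma PLM_I:
  assumes "\<And>N::nat. \<exists>a b. a \<le> - real N \<and> real N \<le> b \<and> F a \<le> - real N \<and> real N \<le> F b \<and> plm F a b"
  shows "F \<in> PLM"
proof -
  have "\<exists>x. F x = y" for y
  proof -
    obtain a b where "F a \<le> - real (nat \<lceil>\<bar>y\<bar>\<rceil>)" "real (nat \<lceil>\<bar>y\<bar>\<rceil>) \<le> F b" "plm F a b"
      using assms by blast
    moreover have "\<bar>y\<bar> \<le> real (nat \<lceil>\<bar>y\<bar>\<rceil>)"
      by linarith
    ultimately have "plm F a b" "F a \<le> y" "y \<le> F b"
      by linarith+
    then show ?thesis
      using plm_image by blast
  qed
  then have "surj F"
    by (metis surjI)
  moreover have "plm F c d" if "c \<in> Z_inv m" "d \<in> Z_inv m" "c \<le> d" for c d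
  proof -
    define N where "N = max (nat \<lceil>\<bar>c\<bar>\<rceil>) (nat \<lceil>\<bar>d\<bar>\<rceil>)"
    have "\<bar>c\<bar> \<le> real N" "\<bar>d\<bar> \<le> real N"
      unfolding N_def by linarith+
    moreover obtain a b where "a \<le> - real N" "real N \<le> b" "plm F a b"
      using assms by blast
    ultimately have "plm F a b" "a \<le> c" "d \<le> b"
      by linarith+
    then show ?thesis
      using that plm_restrict by blast
  qed
  ultimately show ?thesis
    by (simp add: PLM_def)
qed

lemma PLM_strict_mono:
  assumes "F \<in> PLM"
  shows "strict_mono F"
proof (rule strict_monoI)
  fix x y :: real assume "x < y"
  moreover have "plm F (of_int \<lfloor>x\<rfloor>) (of_int \<lceil>y\<rceil>)"
    using assms \<open>x < y\<close> by (intro PLM_plm) (simp, simp, simp, linarith)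
  ultimately show "F x < F y"
    by (rule_tac plm_strict_mono) auto
qed

lemma PLM_surj: "F \<in> PLM \<Longrightarrow> surj F"
  by (simp add: PLM_def)

lemma PLM_inj: "F \<in> PLM \<Longrightarrow> inj F"
  using PLM_strict_mono strict_mono_imp_inj_on by blast

lemma PLM_inv_left [simp]: "F \<in> PLM \<Longrightarrow> inv_into UNIV F (F x) = x"
  using PLM_inj by simp

lemma PLM_inv_right [simp]: "F \<in> PLM \<Longrightarrow> F (inv_into UNIV F x) = x"
  using PLM_surj surj_f_inv_f by fastforce

lemma PLM_continuous:
  assumes "F \<in> PLM"
  shows "continuous_on UNIV F"
  using PLM_surj[OF assms] strict_mono_less_eq[OF PLM_strict_mono[OF assms]]
  by (intro continuous_onI_mono) auto

lemma PLM_Z_inv: "F \<in> PLM \<Longrightarrow> x \<in> Z_inv m \<Longrightarrow> F x \<in> Z_inv m"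
  using PLM_plm[of F x x] plm_Z_inv by blast

text \<open>Hence \<open>F\<close> acts on \<int>[1/m] / (m - 1) as the translation by the class of
  \<open>F 0\<close>.\<close>

lemma PLM_zcong:
  assumes "F \<in> PLM" "x \<in> Z_inv m" "y \<in> Z_inv m"
  shows "zcong (F y - F x) (y - x)"
proof -
  have *: "zcong (F v - F u) (v - u)" if "u \<le> v" "u \<in> Z_inv m" "v \<in> Z_inv m" for u v
    using that assms by (intro plm_zcong PLM_plm)
  show ?thesis
  proof (cases "x \<le> y")
    case False
    then have "zcong (- 1 * (F x - F y)) (- 1 * (x - y))"
      using assms Z_inv_of_int[of "-1"] by (intro zcong_mult *) auto
    then show ?thesis by simp
  qed (use assms * in auto)
qed

lemma PLM_comp:
  assumes "F \<in> PLM" "G \<in> PLM"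
  shows "G \<circ> F \<in> PLM"
proof -
  have "plm (G \<circ> F) a b" if "a \<in> Z_inv m" "b \<in> Z_inv m" "a \<le> b" for a b
  proof -
    have 1: "plm F a b"
      using assms that PLM_plm by blast
    have 2: "plm G (F a) (F b)"
      using assms that PLM_Z_inv strict_mono_less_eq[OF PLM_strict_mono] by (intro PLM_plm) auto
    show ?thesis
      using plm_comp[OF 1 2] by (simp add: o_def)
  qed
  moreover have "surj (G \<circ> F)"
    using assms PLM_surj by (intro comp_surj) auto
  ultimately show ?thesis
    by (simp add: PLM_def)
qed

lemma PLM_inv:
  assumes F: "F \<in> PLM"
  shows "inv_into UNIV F \<in> PLM"
proof (rule PLM_I)
  fix N :: nat
  let ?G = "inv_into UNIV F"
  \<comment> \<open>The window from \<open>- K\<close> to \<open>K\<close> contains the preimages of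
    \<open>N\<close> and \<open>- N\<close>, so its image contains both, and \<open>K\<close> is at
    least \<open>N\<close>.\<close>
  obtain K :: nat where K: "\<bar>?G (- real N)\<bar> + \<bar>?G (real N)\<bar> + real N \<le> real K"
    using real_arch_simple by blast
  have mono: "F x \<le> F y" if "x \<le> y" for x y
    using that strict_mono_less_eq[OF PLM_strict_mono[OF F]] by simp
  have "- real K \<in> Z_inv m"
    using Z_inv_minus by simp
  then have "plm F (- real K) (real K)"
    using F by (intro PLM_plm) auto
  then have "plm ?G (F (- real K)) (F (real K))"
    by (rule plm_inverse) (simp add: F)
  moreover have "F (- real K) \<le> - real N"
    using mono[of "- real K" "?G (- real N)"] K F by simp
  moreover have "F (real K) \<ge> real N"
    using mono[of "?G (real N)" "real K"] K F by simp
  moreover have "?G (F (- real K)) \<le> - real N" "?G (F (real K)) \<ge> real N"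
    using K F by auto
  ultimately show "\<exists>a b. a \<le> - real N \<and> real N \<le> b \<and> ?G a \<le> - real N \<and> real N \<le> ?G b \<and> plm ?G a b"
    by blast
qed

lemma PLM_translation: "c \<in> Z_inv m \<Longrightarrow> (\<lambda>x. x + c) \<in> PLM"
proof -
  assume c: "c \<in> Z_inv m"
  have "surj (\<lambda>x. x + c)"
    by (rule surjI[of _ "\<lambda>x. x - c"]) simp
  moreover have "plm (\<lambda>x. x + c) a b" if "a \<in> Z_inv m" "b \<in> Z_inv m" "a \<le> b" for a b
    using that c by (intro plm_affine[where s = 1]) auto
  ultimately show ?thesis
    by (simp add: PLM_def)
qed

lemma PLM_id: "id \<in> PLM"
  using PLM_translation[of 0] by (simp add: id_def)

lemma PLM_funpow: "F \<in> PLM \<Longrightarrow> F ^^ n \<in> PLM"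
  by (induction n) (auto intro: PLM_id PLM_comp)

section \<open>Equivariant extension from a fundamental domain\<close>

definition int_iter :: "('a \<Rightarrow> 'a) \<Rightarrow> int \<Rightarrow> 'a \<Rightarrow> 'a" where
  "int_iter F n = (if n \<ge> 0 then F ^^ nat n else inv_into UNIV F ^^ nat (- n))"

lemma int_iter_0 [simp]: "int_iter F 0 x = x"
  by (simp add: int_iter_def)

lemma int_iter_Suc:
  assumes "surj F"
  shows "int_iter F (n + 1) x = F (int_iter F n x)"
proof (cases "n \<ge> 0")
  case True
  then show ?thesis
    by (simp add: int_iter_def nat_add_distrib)
next
  case False
  define k where "k = nat (- (n + 1))"
  have "int_iter F (n + 1) x = (inv_into UNIV F ^^ k) x"
    using False by (cases "n = - 1") (auto simp: int_iter_def k_def)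
  moreover have "nat (- n) = Suc k"
    using False by (simp add: k_def)
  ultimately show ?thesis
    using False assms by (simp add: int_iter_def surj_f_inv_f)
qed

text \<open>Glues \<open>n\<close> translates of the domain on each side of 0. It serves both the
  maps \<Psi> of \<open>straighten\<close> and lifts with period \<open>r\<close>; \<open>up\<close>
  and \<open>down\<close> abstract the kind of equivariance.\<close>

lemma plm_fundamental_domain:
  assumes base: "plm F 0 b"
    and up: "\<And>u v. plm F u v \<Longrightarrow> plm F (u + b) (v + b)"
    and down: "\<And>u v. plm F u v \<Longrightarrow> plm F (u - b) (v - b)"
  shows "plm F (- (real n * b)) (real n * b)"
proof -
  have "plm F 0 0"
    using plm_Z_inv[OF base] by (auto intro: plm.refl)
  have "plm F 0 (real n * b)"
  proof (induction n)
    case (Suc n)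
    have "real (Suc n) * b = real n * b + b"
      by (simp add: algebra_simps)
    then show ?case
      using plm_trans[OF up[OF Suc]] base by simp
  qed (simp add: \<open>plm F 0 0\<close>)
  moreover have "plm F (- (real n * b)) 0"
  proof (induction n)
    case (Suc n)
    have "- (real (Suc n) * b) = - (real n * b) - b"
      by (simp add: algebra_simps)
    moreover have "plm F (- b) 0"
      using down[OF base] by simp
    moreover have "plm F (- (real n * b) - b) (- b)"
      using down[OF Suc] by simp
    ultimately show ?case
      using plm_trans by metis
  qed (simp add: \<open>plm F 0 0\<close>)
  ultimately show ?thesis
    using plm_trans by blast
qed

text \<open>Equivariance under the translation by \<open>b\<close> determines \<open>\<Psi>\<close> from its restriction to
  \<open>[0, b]\<close>, which may be any homeomorphism onto the fundamental domain \<open>[0, F 0]\<close> of \<open>F\<close>.\<close>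

lemma straighten:
  assumes F: "F \<in> PLM" and Fq: "\<And>x. (F ^^ q) x = x + c" and "c > 0"
    and b: "b \<in> Z_inv m" "b > 0" "zcong (F 0) b"
  obtains \<Psi> where "\<Psi> \<in> PLM" "\<And>x. \<Psi> (x + b) = F (\<Psi> x)" "\<Psi> 0 = 0"
proof -
  \<comment> \<open>Otherwise monotonicity would keep all iterates of 0 at or below 0, against
    \<open>(F ^^ q) 0 = c\<close>.\<close>
  have "F 0 > 0"
  proof (rule ccontr)
    assume neg: "\<not> F 0 > 0"
    have "(F ^^ n) 0 \<le> 0" for n
    proof (induction n)
      case (Suc n)
      then have "F ((F ^^ n) 0) \<le> F 0"
        using strict_mono_less_eq[OF PLM_strict_mono[OF F]] by blast
      with neg show ?case by simp
    qed simp
    from this[of q] show False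
      using Fq \<open>c > 0\<close> by simp
  qed
  then have "plm_equiv b (F 0)"
    using F b zcong_sym PLM_Z_inv by (intro plm_equiv_if_zcong) auto
  then obtain h where h: "plm h 0 b" "h 0 = 0" "h b = F 0"
    by (auto simp: plm_equiv_def)
  \<comment> \<open>Writing x = n b + t with t in [0, b), the value is the n-th iterate of
    \<open>F\<close> at \<open>h t\<close>; n may be negative.\<close>
  define \<Psi> where "\<Psi> x = int_iter F \<lfloor>x / b\<rfloor> (h (x - b * of_int \<lfloor>x / b\<rfloor>))" for x
  have equi: "\<Psi> (x + b) = F (\<Psi> x)" for x
  proof -
    have "(x + b) / b = x / b + 1"
      using b by (simp add: field_simps)
    then have "\<lfloor>(x + b) / b\<rfloor> = \<lfloor>x / b\<rfloor> + 1"
      by simp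
    then show ?thesis
      using int_iter_Suc[OF PLM_surj[OF F], of "\<lfloor>x / b\<rfloor>"] by (simp add: \<Psi>_def algebra_simps)
  qed
  have zero: "\<Psi> 0 = 0"
    using h by (simp add: \<Psi>_def)
  have base: "plm \<Psi> 0 b"
  proof (rule plm_cong[OF h(1)])
    fix x assume x: "0 \<le> x" "x \<le> b"
    show "h x = \<Psi> x"
    proof (cases "x = b")
      \<comment> \<open>At the right end the floor is already 1, so the value comes from
        equivariance and \<open>h b = F 0\<close>.\<close>
      case True
      then show ?thesis
        using equi[of 0] zero h by simp
    next
      case False
      with x b have "\<lfloor>x / b\<rfloor> = 0"
        by (simp add: floor_eq_iff)
      then show ?thesis
        by (simp add: \<Psi>_def)
    qed
  qed
  \<comment> \<open>On the translated interval, \<Psi> is the shift by \<open>- b\<close> followed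
    by \<Psi> and \<open>F\<close>; for \<open>down\<close> the inverse of \<open>F\<close> is
    used.\<close>
  have up: "plm \<Psi> (u + b) (v + b)" if "plm \<Psi> u v" for u v
  proof -
    have shift: "plm (\<lambda>x. x + (- b)) (u + b) (v + b)"
      using plm_le[OF that] plm_Z_inv[OF that] b Z_inv_minus[OF b(1)]
      by (intro PLM_plm PLM_translation) auto
    have "plm (F \<circ> \<Psi>) u v"
      using plm_comp[OF that, of F] F plm_Z_inv[OF that] plm_mono[OF that] plm_le[OF that] PLM_plm
      by (simp add: o_def)
    then have "plm (\<lambda>x. (F \<circ> \<Psi>) (x + (- b))) (u + b) (v + b)"
      using plm_comp[OF shift, of "F \<circ> \<Psi>"] by simp
    then show ?thesis
      by (rule plm_cong) (simp flip: equi)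
  qed
  have down: "plm \<Psi> (u - b) (v - b)" if "plm \<Psi> u v" for u v
  proof -
    have shift: "plm (\<lambda>x. x + b) (u - b) (v - b)"
      using plm_le[OF that] plm_Z_inv[OF that] b
      by (intro PLM_plm PLM_translation) auto
    have "plm (inv_into UNIV F \<circ> \<Psi>) u v"
      using plm_comp[OF that, of "inv_into UNIV F"] PLM_inv[OF F] plm_Z_inv[OF that]
        plm_mono[OF that] plm_le[OF that] PLM_plm
      by (simp add: o_def)
    then have "plm (\<lambda>x. (inv_into UNIV F \<circ> \<Psi>) (x + b)) (u - b) (v - b)"
      using plm_comp[OF shift, of "inv_into UNIV F \<circ> \<Psi>"] by simp
    then show ?thesis
      by (rule plm_cong) (simp add: equi F)
  qed
  have iter: "\<Psi> (x + real n * b) = (F ^^ n) (\<Psi> x)" for x n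
  proof (induction n)
    case (Suc n)
    then show ?case
      using equi[of "x + real n * b"] by (simp add: algebra_simps)
  qed simp
  \<comment> \<open>Since \<open>F ^^ q\<close> is a translation, \<Psi> is unbounded in both
    directions, which yields surjectivity.\<close>
  have iter_q: "\<Psi> (x + real (n * q) * b) = \<Psi> x + real n * c" for x n
  proof (induction n)
    case (Suc n)
    then show ?case
      using iter[of "x + real (n * q) * b" q] Fq by (simp add: algebra_simps)
  qed simp
  have "q \<noteq> 0"
    using Fq[of 0] \<open>c > 0\<close> by (cases "q = 0") auto
  have "\<Psi> \<in> PLM"
  proof (rule PLM_I)
    fix N :: nat
    \<comment> \<open>\<open>n1\<close> makes the window large enough in the domain,
      \<open>n2\<close> in the range.\<close>
    obtain n1 n2 :: nat where n12: "real N < real n1 * b" "real N < real n2 * c"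
      using b \<open>c > 0\<close> reals_Archimedean3 by meson
    define n where "n = n1 + n2"
    have "real n1 * b \<le> real n * b" "real n * 1 * b \<le> real n * real q * b"
      using b \<open>q \<noteq> 0\<close> by (intro mult_right_mono mult_left_mono; simp add: n_def)+
    then have n: "real N \<le> real (n * q) * b"
      using n12 by simp
    have "real n2 * c \<le> real n * c"
      using \<open>c > 0\<close> by (simp add: n_def)
    then have n': "real N \<le> real n * c"
      using n12 by simp
    have "plm \<Psi> (- (real (n * q) * b)) (real (n * q) * b)"
      using plm_fundamental_domain[OF base up down] .
    moreover have "\<Psi> (real (n * q) * b) = real n * c"
      using iter_q[of 0 n] zero by simp
    moreover have "\<Psi> (- (real (n * q) * b)) = - (real n * c)"
      using iter_q[of "- (real (n * q) * b)" n] zero by simp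
    ultimately show "\<exists>u v. u \<le> - real N \<and> real N \<le> v \<and> \<Psi> u \<le> - real N \<and> real N \<le> \<Psi> v \<and> plm \<Psi> u v"
      using n n' by (intro exI[of _ "- (real (n * q) * b)"] exI[of _ "real (n * q) * b"]) simp
  qed
  then show ?thesis
    using that equi zero by blast
qed

end

section \<open>Points of the circle and uniqueness of lifts\<close>

lemma circle_pt_eq_iff: "circle_pt r x = circle_pt r y \<longleftrightarrow> (\<exists>k::int. y = x + real r * of_int k)"
proof
  assume "circle_pt r x = circle_pt r y"
  moreover have "y \<in> circle_pt r y"
    unfolding circle_pt_def by (auto intro: exI[of _ 0])
  ultimately show "\<exists>k::int. y = x + real r * of_int k"
    unfolding circle_pt_def by auto
next
  assume "\<exists>k::int. y = x + real r * of_int k"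
  then obtain k :: int where k: "y = x + real r * of_int k" ..
  have "x + real r * of_int l = y + real r * of_int (l - k)" for l :: int
    by (simp add: k algebra_simps)
  moreover have "y + real r * of_int l = x + real r * of_int (l + k)" for l :: int
    by (simp add: k algebra_simps)
  ultimately show "circle_pt r x = circle_pt r y"
    unfolding circle_pt_def by blast
qed

text \<open>The difference divided by \<open>r\<close> is continuous and integer-valued on the
  connected line, hence constant.\<close>

lemma lifts_differ_by_period:
  assumes "r > 0" "is_lift r f F" "is_lift r f G"
  shows "\<exists>k::int. \<forall>x. G x = F x + real r * of_int k"
proof -
  define d where "d x = (G x - F x) / real r" for x
  have "\<exists>k::int. d x = of_int k" for x
  proof -
    have "circle_pt r (F x) = circle_pt r (G x)"
      using assms by (simp add: is_lift_def)
    then show ?thesis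
      using assms(1) by (auto simp: circle_pt_eq_iff d_def)
  qed
  then obtain K :: "real \<Rightarrow> int" where K: "\<And>x. d x = of_int (K x)"
    by metis
  have "continuous_on UNIV d"
    unfolding d_def using assms by (auto simp: is_lift_def intro!: continuous_intros)
  moreover have "1 \<le> norm (d y - d x)" if "d y \<noteq> d x" for x y
    using that unfolding K by (simp flip: of_int_diff add: abs_if)
  ultimately have "d constant_on UNIV"
    by (intro continuous_discrete_range_constant) (auto intro!: exI[of _ 1])
  then obtain c where "\<And>x. d x = c"
    by (auto simp: constant_on_def)
  then have "d x = of_int (K 0)" for x
    by (metis K)
  then have "G x = F x + real r * of_int (K 0)" for x
    using assms(1) by (simp add: d_def field_simps)
  then show ?thesis
    by blast
qed

context m_adic
begin

text \<open>Together with \<open>pieces_imp_plm\<close>, this links the inductive description to the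
  indexed subdivisions of \<open>affine_pieces\<close>.\<close>

lemma plm_imp_pieces:
  "plm F a b \<Longrightarrow> \<exists>p c s. c 0 = a \<and> c p = b \<and> (\<forall>i<p. c i < c (Suc i)) \<and>
     (\<forall>i<p. s i \<in> int_powers m \<and> (\<exists>d. \<forall>x\<in>{c i..c (Suc i)}. F x = s i * x + d)) \<and>
     (\<forall>i\<le>p. c i \<in> Z_inv m)"
proof (induction rule: plm.induct)
  case refl
  \<comment> \<open>A degenerate interval has no pieces, so the slope 1 is a dummy value.\<close>
  then show ?case
    by (intro exI[of _ "0::nat"] exI[of _ "\<lambda>_. a"] exI[of _ "\<lambda>_. 1"]) auto
next
  case (step b c t)
  then obtain p e s where e: "e 0 = a" "e p = b" "\<And>i. i < p \<Longrightarrow> e i < e (Suc i)"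
      "\<And>i. i < p \<Longrightarrow> s i \<in> int_powers m"
      "\<And>i. i < p \<Longrightarrow> \<exists>d. \<forall>x\<in>{e i..e (Suc i)}. F x = s i * x + d"
      "\<And>i. i \<le> p \<Longrightarrow> e i \<in> Z_inv m"
    by blast
  have last: "\<exists>d. \<forall>x\<in>{b..c}. F x = t * x + d"
  proof (intro exI ballI)
    show "F x = t * x + (F b - t * b)" if "x \<in> {b..c}" for x
      using step.hyps(5)[of x] that by (simp add: algebra_simps)
  qed
  show ?case
    by (intro exI[of _ "Suc p"] exI[of _ "e(Suc p := c)"] exI[of _ "s(p := t)"])
      (use e last step.hyps(2-4) in \<open>auto simp: less_Suc_eq le_Suc_eq\<close>)
qed

lemma pieces_imp_plm:
  fixes p :: nat
  assumes "\<And>i. i < p \<Longrightarrow> c i < c (Suc i)" "\<And>i. i < p \<Longrightarrow> s i \<in> int_powers m"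
    and "\<And>i. i < p \<Longrightarrow> \<exists>d. \<forall>x\<in>{c i..c (Suc i)}. F x = s i * x + d"
    and "\<And>i. i \<le> p \<Longrightarrow> c i \<in> Z_inv m" "F (c 0) \<in> Z_inv m"
  shows "plm F (c 0) (c p)"
proof -
  have "plm F (c 0) (c i)" if "i \<le> p" for i
    using that
  proof (induction i)
    case 0
    then show ?case
      using assms by (auto intro: plm.refl)
  next
    case (Suc i)
    then obtain d where d: "\<And>x. x \<in> {c i..c (Suc i)} \<Longrightarrow> F x = s i * x + d"
      using assms(3)[of i] by auto
    show ?case
    proof (rule plm.step)
      show "plm F (c 0) (c i)" "c i < c (Suc i)" "c (Suc i) \<in> Z_inv m" "s i \<in> int_powers m"
        using Suc assms by auto
      show "F x = F (c i) + s i * (x - c i)" if "c i \<le> x" "x \<le> c (Suc i)" for x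
        using d[of x] d[of "c i"] that by (simp add: algebra_simps)
    qed
  qed
  then show ?thesis
    by simp
qed

end

section \<open>The Brown-Thompson group as a group of lifts\<close>

locale brown_thompson = m_adic +
  fixes r :: nat
  assumes r_ge_1: "r \<ge> 1"
begin

text \<open>The group of all lifts of elements of the Brown-Thompson group, by
  \<open>Brown_Thompson_set_eq\<close>; commuting with the translation by \<open>r\<close> encodes
  degree one.\<close>

definition lifts :: "(real \<Rightarrow> real) set" where
  "lifts = {F \<in> PLM. \<forall>x. F (x + real r) = F x + real r}"

lemma lifts_PLM: "F \<in> lifts \<Longrightarrow> F \<in> PLM"
  by (simp add: lifts_def)

lemma lifts_add_int: "F \<in> lifts \<Longrightarrow> F (x + real r * of_int k) = F x + real r * of_int k"
proof -
  assume F: "F \<in> lifts"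
  have nat: "F (x + real r * real n) = F x + real r * real n" for x n
  proof (induction n)
    case (Suc n)
    have "F (x + real r * real n + real r) = F (x + real r * real n) + real r"
      using F by (simp add: lifts_def)
    with Suc show ?case
      by (simp add: algebra_simps)
  qed simp
  \<comment> \<open>For negative \<open>k\<close> the natural case is applied at the shifted
    point.\<close>
  show ?thesis
    using nat[of x "nat k"] nat[of "x + real r * of_int k" "nat (- k)"] by (cases "k \<ge> 0") auto
qed

lemma id_lifts: "id \<in> lifts"
  using PLM_id by (simp add: lifts_def)

lemma lifts_comp: "F \<in> lifts \<Longrightarrow> G \<in> lifts \<Longrightarrow> G \<circ> F \<in> lifts"
  using PLM_comp by (simp add: lifts_def)

lemma lifts_funpow: "F \<in> lifts \<Longrightarrow> F ^^ n \<in> lifts"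
  by (induction n) (auto intro: id_lifts lifts_comp)

lemma lifts_inv: "F \<in> lifts \<Longrightarrow> inv_into UNIV F \<in> lifts"
proof -
  assume F: "F \<in> lifts"
  let ?G = "inv_into UNIV F"
  have "F (?G x + real r) = x + real r" for x
    using F by (simp add: lifts_def)
  then have "?G (x + real r) = ?G x + real r" for x
    by (metis F PLM_inv_left lifts_PLM)
  then show ?thesis
    using F PLM_inv by (simp add: lifts_def)
qed

lemma lifts_add: "F \<in> lifts \<Longrightarrow> (\<lambda>x. F x + real r * of_int k) \<in> lifts"
proof -
  assume F: "F \<in> lifts"
  have "(\<lambda>x. x + real r * of_int k) \<circ> F \<in> PLM"
    using F by (intro PLM_comp PLM_translation Z_inv_mult) (auto simp: lifts_def)
  then show ?thesis
    using F by (simp add: lifts_def o_def)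
qed

text \<open>Conjugation by the translation by \<open>r\<close> carries the description on one period
  to every other period.\<close>

lemma lifts_I:
  assumes per: "\<And>x. F (x + real r) = F x + real r" and F: "plm F 0 (real r)"
  shows "F \<in> lifts"
proof -
  have per': "F (x - real r) = F x - real r" for x
    using per[of "x - real r"] by simp
  have rZ: "- real r \<in> Z_inv m" "real r \<in> Z_inv m"
    using Z_inv_minus by auto
  have up: "plm F (u + real r) (v + real r)" if uv: "plm F u v" for u v
  proof -
    have 1: "plm (\<lambda>x. x + (- real r)) (u + real r) (v + real r)"
      using plm_le[OF uv] plm_Z_inv[OF uv] rZ by (intro PLM_plm PLM_translation) auto
    have "plm (\<lambda>x. F (x + (- real r))) (u + real r) (v + real r)"
      using plm_comp[OF 1, of F] uv by simp
    moreover have "plm (\<lambda>x. x + real r) (F u - real r + real r) (F v - real r + real r)"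
      using plm_mono[OF uv] plm_le[OF uv] plm_Z_inv[OF uv] rZ by (intro PLM_plm PLM_translation) auto
    ultimately have "plm (\<lambda>x. F (x + (- real r)) + real r) (u + real r) (v + real r)"
      using plm_comp[of "\<lambda>x. F (x + (- real r))" _ _ "\<lambda>x. x + real r"] by simp
    then show ?thesis
      by (rule plm_cong) (simp add: per')
  qed
  have down: "plm F (u - real r) (v - real r)" if uv: "plm F u v" for u v
  proof -
    have 1: "plm (\<lambda>x. x + real r) (u - real r) (v - real r)"
      using plm_le[OF uv] plm_Z_inv[OF uv] rZ by (intro PLM_plm PLM_translation) auto
    have "plm (\<lambda>x. F (x + real r)) (u - real r) (v - real r)"
      using plm_comp[OF 1, of F] uv by simp
    moreover have "plm (\<lambda>x. x + (- real r)) (F u) (F v)"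
      using plm_mono[OF uv] plm_le[OF uv] plm_Z_inv[OF uv] rZ by (intro PLM_plm PLM_translation) auto
    ultimately have "plm (\<lambda>x. F (x + real r) + (- real r)) (u - real r) (v - real r)"
      using plm_comp[of "\<lambda>x. F (x + real r)" _ _ "\<lambda>x. x + (- real r)"] by simp
    then show ?thesis
      by (rule plm_cong) (simp add: per)
  qed
  have iter: "F (x + real n * real r) = F x + real n * real r" for x n
  proof (induction n)
    case (Suc n)
    then show ?case
      using per[of "x + real n * real r"] by (simp add: algebra_simps)
  qed simp
  have "F \<in> PLM"
  proof (rule PLM_I)
    fix N :: nat
    \<comment> \<open>\<open>K\<close> absorbs the offset \<open>F 0\<close>, so that N + K periods
      cover the required range.\<close>
    obtain K :: nat where K: "\<bar>F 0\<bar> \<le> real K"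
      using real_arch_simple by blast
    define n where "n = N + K"
    have "real n * 1 \<le> real n * real r"
      using r_ge_1 by (intro mult_left_mono) auto
    then have n: "real N + real K \<le> real n * real r"
      by (simp add: n_def)
    have "plm F (- (real n * real r)) (real n * real r)"
      using plm_fundamental_domain[OF F up down] .
    moreover have "F (real n * real r) = F 0 + real n * real r"
      using iter[of 0 n] by simp
    moreover have "F (- (real n * real r)) = F 0 - real n * real r"
      using iter[of "- (real n * real r)" n] by simp
    ultimately show "\<exists>u v. u \<le> - real N \<and> real N \<le> v \<and> F u \<le> - real N \<and> real N \<le> F v \<and> plm F u v"
      using n K by (intro exI[of _ "- (real n * real r)"] exI[of _ "real n * real r"]) auto
  qed
  then show ?thesis
    using per by (simp add: lifts_def)
qed

section \<open>From lifts to maps of the circle\<close>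

definition proj :: "(real \<Rightarrow> real) \<Rightarrow> real set \<Rightarrow> real set" where
  "proj F = (\<lambda>c\<in>circle r. circle_pt r (F (SOME x. circle_pt r x = c)))"

text \<open>Two representatives of a point differ by a multiple of \<open>r\<close>, which
  \<open>F\<close> preserves, so the choice made in \<open>proj\<close> is immaterial.\<close>

lemma proj_circle_pt [simp]:
  assumes "F \<in> lifts"
  shows "proj F (circle_pt r x) = circle_pt r (F x)"
proof -
  define y where "y = (SOME y. circle_pt r y = circle_pt r x)"
  have "circle_pt r y = circle_pt r x"
    unfolding y_def by (rule someI) (rule HOL.refl)
  then obtain k :: int where "x = y + real r * of_int k"
    by (auto simp: circle_pt_eq_iff)
  then have "circle_pt r (F y) = circle_pt r (F x)"
    using lifts_add_int[OF assms] by (auto simp: circle_pt_eq_iff)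
  then show ?thesis
    by (simp add: proj_def circle_def y_def)
qed

lemma proj_is_lift: "F \<in> lifts \<Longrightarrow> is_lift r (proj F) F"
  using PLM_continuous by (simp add: is_lift_def lifts_PLM)

lemma proj_extensional: "proj F \<in> extensional (circle r)"
  by (simp add: proj_def)

lemma proj_eqI:
  assumes "F \<in> lifts" "f \<in> extensional (circle r)" "\<And>x. f (circle_pt r x) = circle_pt r (F x)"
  shows "f = proj F"
  by (rule extensionalityI[OF assms(2) proj_extensional]) (use assms in \<open>auto simp: circle_def\<close>)

text \<open>The kernel of the projection consists of the translations by multiples of
  \<open>r\<close>; identities in the group become identities of lifts up to such a
  translation.\<close>

lemma proj_eq_iff:
  assumes "F \<in> lifts" "G \<in> lifts"
  shows "proj F = proj G \<longleftrightarrow> (\<exists>k::int. \<forall>x. G x = F x + real r * of_int k)"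
proof
  assume "proj F = proj G"
  then show "\<exists>k::int. \<forall>x. G x = F x + real r * of_int k"
    using proj_is_lift[OF assms(1)] proj_is_lift[OF assms(2)] r_ge_1
    by (intro lifts_differ_by_period[of r "proj F"]) auto
next
  assume "\<exists>k::int. \<forall>x. G x = F x + real r * of_int k"
  then show "proj F = proj G"
    using assms by (intro proj_eqI proj_extensional) (auto simp: circle_pt_eq_iff)
qed

lemma compose_proj:
  assumes "F \<in> lifts" "G \<in> lifts"
  shows "compose (circle r) (proj F) (proj G) = proj (F \<circ> G)"
  using assms by (intro proj_eqI lifts_comp) (auto simp: compose_def circle_def)

lemma continuous_map_proj:
  assumes "F \<in> lifts"
  shows "continuous_map (circle_topology r) (circle_topology r) (proj F)"
proof (rule continuous_compose_quotient_map[OF quotient_map_circle_pt])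
  have "continuous_map euclidean euclidean F"
    using PLM_continuous[OF lifts_PLM[OF assms]] by simp
  then have "continuous_map euclidean (circle_topology r) (circle_pt r \<circ> F)"
    using quotient_imp_continuous_map[OF quotient_map_circle_pt] by (rule continuous_map_compose)
  moreover have "proj F \<circ> circle_pt r = circle_pt r \<circ> F"
    using assms by auto
  ultimately show "continuous_map euclidean (circle_topology r) (proj F \<circ> circle_pt r)"
    by simp
qed

lemma homeomorphic_map_proj:
  assumes "F \<in> lifts"
  shows "homeomorphic_map (circle_topology r) (circle_topology r) (proj F)"
proof -
  have "homeomorphic_maps (circle_topology r) (circle_topology r) (proj F) (proj (inv_into UNIV F))"
    unfolding homeomorphic_maps_def
    using assms lifts_inv[OF assms] lifts_PLM[OF assms]
    by (auto simp: continuous_map_proj circle_def)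
  then show ?thesis
    by (rule homeomorphic_maps_imp_map)
qed

lemma proj_Brown_Thompson_set:
  assumes F: "F \<in> lifts"
  shows "proj F \<in> Brown_Thompson_set r m"
proof -
  have "plm F 0 (real r)"
    using lifts_PLM[OF F] by (intro PLM_plm) auto
  from plm_imp_pieces[OF this] obtain p a s where
    pcs: "a 0 = 0 \<and> a p = real r \<and> (\<forall>i<p. a i < a (Suc i)) \<and>
      (\<forall>i<p. s i \<in> int_powers m \<and> (\<exists>d. \<forall>x\<in>{a i..a (Suc i)}. F x = s i * x + d)) \<and>
      (\<forall>i\<le>p. a i \<in> Z_inv m)"
    by blast
  then have aff: "affine_pieces r F p a s"
    by (simp add: affine_pieces_def)
  have "proj F \<in> homeo_plus r"
    unfolding homeo_plus_def
    using homeomorphic_map_proj[OF F] proj_extensional proj_is_lift[OF F] PLM_strict_mono lifts_PLM[OF F]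
    by blast
  then have "proj F \<in> PL_plus r"
    unfolding PL_plus_def using proj_is_lift[OF F] aff by blast
  moreover have "\<forall>i\<le>p. a i \<in> Z_inv m \<and> proj F (circle_pt r (a i)) \<in> circle_pt r ` Z_inv m"
    using pcs F PLM_Z_inv lifts_PLM by auto
  ultimately show ?thesis
    unfolding Brown_Thompson_set_def mem_Collect_eq using proj_is_lift[OF F] aff pcs
    by (intro conjI exI[of _ F] exI[of _ p] exI[of _ a] exI[of _ s]) auto
qed

text \<open>The definitions supply one lift that is increasing and another that is piecewise affine.
  They differ by a constant, so the latter is increasing too, and injectivity of \<open>f\<close>
  forces degree one.\<close>

lemma Brown_Thompson_set_imp_proj:
  assumes f: "f \<in> Brown_Thompson_set r m"
  obtains F where "F \<in> lifts" "f = proj F"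
proof -
  have r: "real r > 0" "r > 0"
    using r_ge_1 by auto
  have "f \<in> homeo_plus r"
    using f by (simp add: Brown_Thompson_set_def PL_plus_def)
  then obtain F1 where ext: "f \<in> extensional (circle r)"
    and hom: "homeomorphic_map (circle_topology r) (circle_topology r) f"
    and F1: "is_lift r f F1" "strict_mono F1"
    by (auto simp: homeo_plus_def)
  obtain F p a s where F: "is_lift r f F" and aff: "affine_pieces r F p a s"
    and sl: "\<And>i. i < p \<Longrightarrow> s i \<in> int_powers m"
    and br: "\<And>i. i \<le> p \<Longrightarrow> a i \<in> Z_inv m"
    and im: "\<And>i. i \<le> p \<Longrightarrow> f (circle_pt r (a i)) \<in> circle_pt r ` Z_inv m"
    using f unfolding Brown_Thompson_set_def by blast
  obtain k :: int where "\<And>x. F x = F1 x + real r * of_int k"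
    using lifts_differ_by_period[OF r(2) F1(1) F] by blast
  then have mono: "F x < F y" if "x < y" for x y
    using that F1(2) by (simp add: strict_mono_def)
  have lift: "circle_pt r (F x) = f (circle_pt r x)" for x
    using F by (simp add: is_lift_def)
  have cont: "continuous_on UNIV F"
    using F by (simp add: is_lift_def)
  have "circle_pt r (x + real r) = circle_pt r x" for x
    unfolding circle_pt_eq_iff by (intro exI[of _ "-1"]) simp
  moreover have "continuous_on UNIV (\<lambda>x. F (x + real r))"
    using cont by (rule continuous_on_compose2) (auto intro!: continuous_intros)
  ultimately have "is_lift r f (\<lambda>x. F (x + real r))"
    by (simp add: is_lift_def lift)
  \<comment> \<open>\<open>d\<close> is the degree of \<open>f\<close>, obtained by comparing
    \<open>F\<close> with its shift by one period.\<close>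
  then obtain d :: int where d: "\<And>x. F (x + real r) = F x + real r * of_int d"
    using lifts_differ_by_period[OF r(2) F] by blast
  have inj: "inj_on f (circle r)"
    using hom homeomorphic_imp_injective_map by fastforce
  have "d \<ge> 1"
    using mono[of 0 "real r"] d[of 0] r by (simp add: zero_less_mult_iff)
  \<comment> \<open>With degree at least 2 the value \<open>F 0 + r\<close> would be taken strictly
    inside the period, so \<open>f\<close> would identify two distinct points.\<close>
  moreover have "d \<le> 1"
  proof (rule ccontr)
    assume "\<not> d \<le> 1"
    then have "2 \<le> d"
      by simp
    then have "real r * 2 \<le> real r * of_int d"
      using r by (intro mult_left_mono) auto
    then have "F 0 + real r < F (real r)"
      using d[of 0] r by simp
    then obtain y where y: "0 \<le> y" "y \<le> real r" "F y = F 0 + real r"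
      using IVT'[of F 0 "F 0 + real r" "real r"] cont r continuous_on_subset by force
    then have "y \<noteq> 0" "y \<noteq> real r"
      using \<open>F 0 + real r < F (real r)\<close> r by auto
    then have y': "0 < y" "y < real r"
      using y by auto
    have "circle_pt r (F 0) = circle_pt r (F y)"
      unfolding circle_pt_eq_iff using y by (intro exI[of _ 1]) simp
    then have "f (circle_pt r 0) = f (circle_pt r y)"
      by (simp add: lift)
    then have "circle_pt r 0 = circle_pt r y"
      using inj by (simp add: inj_on_eq_iff circle_def)
    then obtain l :: int where "y = real r * of_int l"
      by (auto simp: circle_pt_eq_iff)
    with y' r have "0 < l" "of_int l < (1::real)"
      by (auto simp: zero_less_mult_iff)
    then show False
      by simp
  qed
  ultimately have per: "F (x + real r) = F x + real r" for x
    using d by simp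
  \<comment> \<open>The hypothesis on the image of 0 fixes \<open>F 0\<close> only up to multiples
    of \<open>r\<close>, which lie in \<open>Z_inv m\<close>.\<close>
  have "F 0 \<in> Z_inv m"
  proof -
    obtain z where "z \<in> Z_inv m" "circle_pt r z = circle_pt r (F 0)"
      using im[of 0] aff by (auto simp: affine_pieces_def lift)
    then obtain j :: int where "F 0 = z + real r * of_int j" "z \<in> Z_inv m"
      by (auto simp: circle_pt_eq_iff)
    then show ?thesis
      by (auto intro!: Z_inv_add Z_inv_mult)
  qed
  then have "plm F (a 0) (a p)"
    using aff sl br by (intro pieces_imp_plm[where s = s]) (auto simp: affine_pieces_def)
  then have "F \<in> lifts"
    using aff per by (intro lifts_I) (auto simp: affine_pieces_def)
  moreover have "f = proj F"
    by (rule proj_eqI) (use \<open>F \<in> lifts\<close> ext lift in auto)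
  ultimately show ?thesis
    using that by blast
qed

lemma Brown_Thompson_set_eq: "Brown_Thompson_set r m = proj ` lifts"
  using proj_Brown_Thompson_set Brown_Thompson_set_imp_proj by blast

lemma proj_Bij: "F \<in> lifts \<Longrightarrow> proj F \<in> Bij (circle r)"
  using homeomorphic_imp_injective_map[OF homeomorphic_map_proj]
    homeomorphic_imp_surjective_map[OF homeomorphic_map_proj] proj_extensional
  by (simp add: Bij_def bij_betw_def)

section \<open>Group operations expressed through lifts\<close>

abbreviation T where "T \<equiv> Brown_Thompson r m"

lemma carrier_T: "carrier T = proj ` lifts"
  by (simp add: Brown_Thompson_def Brown_Thompson_set_eq)

lemma mult_T: "F \<in> lifts \<Longrightarrow> G \<in> lifts \<Longrightarrow> proj F \<otimes>\<^bsub>T\<^esub> proj G = proj (F \<circ> G)"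
  by (simp add: Brown_Thompson_def BijGroup_def proj_Bij compose_proj)

lemma one_T: "\<one>\<^bsub>T\<^esub> = proj id"
proof -
  have "\<one>\<^bsub>T\<^esub> = (\<lambda>x\<in>circle r. x)"
    by (simp add: Brown_Thompson_def BijGroup_def)
  also have "\<dots> = proj id"
    by (rule proj_eqI[OF id_lifts]) (auto simp: circle_def)
  finally show ?thesis .
qed

lemma group_T: "group T"
proof (rule groupI)
  fix x y z assume "x \<in> carrier T" "y \<in> carrier T"
  then show "x \<otimes>\<^bsub>T\<^esub> y \<in> carrier T"
    using lifts_comp by (auto simp: carrier_T mult_T)
  assume "z \<in> carrier T"
  with \<open>x \<in> carrier T\<close> \<open>y \<in> carrier T\<close> show "x \<otimes>\<^bsub>T\<^esub> y \<otimes>\<^bsub>T\<^esub> z = x \<otimes>\<^bsub>T\<^esub> (y \<otimes>\<^bsub>T\<^esub> z)"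
    using lifts_comp by (auto simp: carrier_T mult_T o_assoc)
next
  show "\<one>\<^bsub>T\<^esub> \<in> carrier T"
    using id_lifts by (auto simp: carrier_T one_T)
next
  fix x assume "x \<in> carrier T"
  then obtain F where F: "F \<in> lifts" "x = proj F"
    by (auto simp: carrier_T)
  show "\<one>\<^bsub>T\<^esub> \<otimes>\<^bsub>T\<^esub> x = x"
    using F id_lifts by (simp add: one_T mult_T)
  have "inv_into UNIV F \<circ> F = id"
    using PLM_inv_left[OF lifts_PLM[OF F(1)]] by auto
  then have "proj (inv_into UNIV F) \<otimes>\<^bsub>T\<^esub> x = \<one>\<^bsub>T\<^esub>"
    using F lifts_inv by (simp add: one_T mult_T)
  then show "\<exists>y\<in>carrier T. y \<otimes>\<^bsub>T\<^esub> x = \<one>\<^bsub>T\<^esub>"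
    using F lifts_inv by (auto simp: carrier_T)
qed

lemma pow_T: "F \<in> lifts \<Longrightarrow> proj F [^]\<^bsub>T\<^esub> (n::nat) = proj (F ^^ n)"
proof (induction n)
  case 0
  interpret group T by (rule group_T)
  show ?case
    by (simp add: one_T id_def)
next
  case (Suc n)
  interpret group T by (rule group_T)
  show ?case
    using Suc lifts_funpow by (simp add: mult_T o_def funpow_swap1)
qed

end

text \<open>The criterion is free of inverses, so that it turns into an equation between
  compositions of lifts, up to a translation.\<close>

lemma (in group) conjugacy_orbit_eq_iff:
  fixes cls
  defines "cls \<equiv> orbit G (\<lambda>g. \<lambda>h \<in> carrier G. g \<otimes> h \<otimes> inv g)"
  assumes x: "x \<in> carrier G" and y: "y \<in> carrier G"
  shows "cls x = cls y \<longleftrightarrow> (\<exists>h\<in>carrier G. h \<otimes> x = y \<otimes> h)"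
proof -
  have cls: "cls z = {g \<otimes> z \<otimes> inv g |g. g \<in> carrier G}" if "z \<in> carrier G" for z
    using that by (auto simp: cls_def orbit_def)
  have sub: "cls b \<subseteq> cls a"
    if ab: "a \<in> carrier G" "b \<in> carrier G" "h \<in> carrier G" "h \<otimes> a = b \<otimes> h" for a b h
  proof -
    have "b = h \<otimes> a \<otimes> inv h"
      using ab by (simp add: inv_solve_right)
    then have "g \<otimes> b \<otimes> inv g = (g \<otimes> h) \<otimes> a \<otimes> inv (g \<otimes> h)" if "g \<in> carrier G" for g
    proof -
      have "h \<otimes> (inv h \<otimes> inv g) = inv g"
        using that ab by (simp flip: m_assoc)
      then show ?thesis
        using that ab(1,3) by (simp add: \<open>b = h \<otimes> a \<otimes> inv h\<close> m_assoc inv_mult_group)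
    qed
    then show ?thesis
      using ab cls by fastforce
  qed
  show ?thesis
  proof
    assume eq: "cls x = cls y"
    have "y = \<one> \<otimes> y \<otimes> inv \<one>"
      using y by simp
    then have "y \<in> cls y"
      unfolding cls[OF y] using one_closed by blast
    then obtain h where "h \<in> carrier G" "y = h \<otimes> x \<otimes> inv h"
      using eq cls[OF x] by auto
    then have "h \<otimes> x = y \<otimes> h"
      using x by (simp add: m_assoc)
    with \<open>h \<in> carrier G\<close> show "\<exists>h\<in>carrier G. h \<otimes> x = y \<otimes> h" ..
  next
    assume "\<exists>h\<in>carrier G. h \<otimes> x = y \<otimes> h"
    then obtain h where h: "h \<in> carrier G" "h \<otimes> x = y \<otimes> h" ..
    then have "inv h \<otimes> y = x \<otimes> inv h"
      using x y by (metis inv_closed inv_solve_left inv_solve_right m_assoc m_closed)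
    with h show "cls x = cls y"
      using sub[OF x y h] sub[OF y x, of "inv h"] by blast
  qed
qed

text \<open>Dividing by d = gcd n q leaves an invertible coefficient modulo n / d, so the solutions
  form one residue class modulo n / d, which has d members below n.\<close>

lemma card_linear_cong:
  fixes n q r :: nat
  assumes "n \<ge> 1"
  shows "card {b. b < n \<and> [q * b = r] (mod n)} = (if gcd n q dvd r then gcd n q else 0)"
proof (cases "gcd n q dvd r")
  case False
  have "\<not> [q * b = r] (mod n)" for b
  proof
    assume "[q * b = r] (mod n)"
    then have "[q * b = r] (mod gcd n q)"
      by (rule cong_dvd_modulus_nat) simp
    moreover have "gcd n q dvd q * b"
      by simp
    ultimately show False
      using False cong_dvd_iff by metis
  qed
  with False show ?thesis
    by simp
next
  case True
  define d n' q' where "d = gcd n q" and "n' = n div d" and "q' = q div d"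
  have d: "d > 0" "n = n' * d" "q = q' * d"
    using assms by (auto simp: d_def n'_def q'_def)
  have "coprime n' q'"
    unfolding n'_def q'_def d_def using assms by (intro div_gcd_coprime) auto
  \<comment> \<open>A Bezout coefficient, scaled by \<open>r div d\<close>, gives a particular
    solution.\<close>
  obtain x where "[q * x = gcd q n] (mod n)"
    using cong_solve_nat by blast
  then have "[q * x * (r div d) = d * (r div d)] (mod n)"
    by (intro cong_mult) (auto simp: d_def gcd.commute)
  then have x0: "[q * (x * (r div d)) = r] (mod n)"
    using dvd_mult_div_cancel[of d r] True unfolding d_def[symmetric] by (simp only: mult.assoc)
  define c where "c = (x * (r div d)) mod n'"
  have n': "n' > 0"
    using assms d(2) by (metis gr0I mult_0 not_one_le_zero)
  have "[q * b = r] (mod n) \<longleftrightarrow> b mod n' = c" for b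
  proof -
    have "[q * b = r] (mod n) \<longleftrightarrow> [q * b = q * (x * (r div d))] (mod n)"
      using x0 cong_trans cong_sym by blast
    also have "\<dots> \<longleftrightarrow> [d * (q' * b) = d * (q' * (x * (r div d)))] (mod (d * n'))"
      by (simp only: d(2,3) ac_simps)
    also have "\<dots> \<longleftrightarrow> [q' * b = q' * (x * (r div d))] (mod n')"
      using d(1) by (simp add: cong_def)
    also have "\<dots> \<longleftrightarrow> [b = x * (r div d)] (mod n')"
      using \<open>coprime n' q'\<close> by (intro cong_mult_lcancel_nat) (simp add: coprime_commute)
    finally show ?thesis
      by (simp add: cong_def c_def)
  qed
  then have "{b. b < n \<and> [q * b = r] (mod n)} = {b. b < n' * d \<and> b mod n' = c}"
    using d(2) by simp
  also have "\<dots> = (\<lambda>j. c + n' * j) ` {..<d}"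
  proof safe
    fix b assume b: "b < n' * d" "c = b mod n'"
    have "b div n' < d"
      using b n' by (simp add: less_mult_imp_div_less mult.commute)
    then show "b \<in> (\<lambda>j. b mod n' + n' * j) ` {..<d}"
      by (intro image_eqI[of _ _ "b div n'"]) auto
  next
    fix j assume "j < d"
    then have "n' * (j + 1) \<le> n' * d"
      by (intro mult_le_mono2) simp
    moreover have "c < n'"
      using n' by (simp add: c_def)
    then have "c + n' * j < n' * (j + 1)"
      by simp
    ultimately show "c + n' * j < n' * d"
      by linarith
    show "(c + n' * j) mod n' = c"
      by (simp add: c_def)
  qed
  also have "card \<dots> = d"
    using n' by (subst card_image) (auto simp: inj_on_def)
  finally show ?thesis
    using True by (simp add: d_def)
qed

section \<open>Iterates of maps of the line, and residues\<close>

lemma funpow_translation: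
  fixes F :: "real \<Rightarrow> real"
  assumes "\<And>x. F x = x + c"
  shows "(F ^^ n) x = x + real n * c"
  by (induction n) (auto simp: assms algebra_simps)

text \<open>A point that moves drifts strictly in one direction under iteration and never returns.
  Hence lifts have no nontrivial torsion.\<close>

lemma strict_mono_funpow_fixed:
  fixes K :: "real \<Rightarrow> real"
  assumes "strict_mono K" "(K ^^ n) x = x" "n \<ge> 1"
  shows "K x = x"
proof (rule ccontr)
  assume "K x \<noteq> x"
  then consider "K x > x" | "K x < x" by linarith
  then show False
  proof cases
    case 1
    have "(K ^^ Suc j) x > x" for j
    proof (induction j)
      case (Suc j)
      then have "K ((K ^^ Suc j) x) > K x"
        using assms(1) by (simp add: strict_mono_def)
      with 1 show ?case by simp
    qed (use 1 in simp)
    from this[of "n - 1"] show False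
      using assms by simp
  next
    case 2
    have "(K ^^ Suc j) x < x" for j
    proof (induction j)
      case (Suc j)
      then have "K ((K ^^ Suc j) x) < K x"
        using assms(1) by (simp add: strict_mono_def)
      with 2 show ?case by simp
    qed (use 2 in simp)
    from this[of "n - 1"] show False
      using assms by simp
  qed
qed

lemma inverse_mod_eq:
  fixes p q :: nat
  assumes "coprime p q" "q \<ge> 2"
  obtains j l where "p * j = 1 + l * q"
proof -
  obtain j where "[p * j = 1] (mod q)"
    using cong_solve_coprime_nat[OF assms(1)] by auto
  then have "p * j mod q = 1"
    using assms by (simp add: cong_def)
  then have "p * j = 1 + (p * j div q) * q"
    by (metis add.commute div_mult_mod_eq)
  with that show ?thesis .
qed

text \<open>The interval excludes 0 and includes \<open>q\<close>, as in the definition of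
  \<open>totatives\<close>.\<close>

lemma congruent_in_interval_unique:
  fixes p p' q :: nat
  assumes "p \<in> {0<..q}" "p' \<in> {0<..q}" "int p' = int p + k * int q"
  shows "p = p'"
proof -
  have "0 < int p" "int p \<le> int q" "0 < int p'" "int p' \<le> int q"
    using assms by auto
  then have "k * int q < 1 * int q" "- 1 * int q < k * int q" "int q > 0"
    using assms(3) by linarith+
  then have "k < 1" "- 1 < k"
    using mult_less_cancel_right_pos by blast+
  then have "k = 0" by simp
  with assms show ?thesis by simp
qed

lemma circle_pt_1_eq_iff:
  assumes "q > 0"
  shows "circle_pt 1 (of_int a / real q) = circle_pt 1 (of_int b / real q) \<longleftrightarrow>
    (\<exists>k. b = a + k * int q)"
proof -
  have "of_int b / real q = of_int a / real q + real 1 * of_int k \<longleftrightarrow> b = a + k * int q" for k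
  proof -
    have "of_int b / real q = of_int a / real q + real 1 * of_int k \<longleftrightarrow>
        (of_int b :: real) = of_int (a + k * int q)"
      using assms by (simp add: field_simps)
    then show ?thesis
      by linarith
  qed
  then show ?thesis
    by (simp add: circle_pt_eq_iff)
qed

context brown_thompson
begin

section \<open>Rotation numbers of elements of finite order\<close>

lemma lifts_strict_mono: "F \<in> lifts \<Longrightarrow> strict_mono F"
  by (simp add: lifts_PLM PLM_strict_mono)

lemma funpow_add_const:
  assumes "F \<in> lifts"
  shows "((\<lambda>x. F x + real r * of_int k) ^^ n) x = (F ^^ n) x + real r * of_int (k * int n)"
proof (induction n)
  case (Suc n)
  show ?case
    using lifts_add_int[OF assms, of "(F ^^ n) x" "k * int n"] Suc by (simp add: algebra_simps)
qed simp

lemma funpow_mult_translation: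
  assumes "\<And>x. (F ^^ q) x = x + real r * of_int k"
  shows "(F ^^ (q * n)) x = x + real r * of_int (k * int n)"
  using funpow_translation[of "F ^^ q", OF assms] by (simp add: funpow_mult algebra_simps)

text \<open>Dividing n by \<open>q\<close> with remainder shows that \<open>(F ^^ n) 0\<close> stays
  at bounded distance from n r p / q.\<close>

lemma rotation_number_proj:
  fixes p :: int
  assumes F: "F \<in> lifts" and Fq: "\<And>x. (F ^^ q) x = x + real r * of_int p" and "q > 0"
  shows "rotation_number r (proj F) = circle_pt 1 (of_int p / real q)"
proof -
  have r: "real r > 0" "r > 0"
    using r_ge_1 by auto
  \<comment> \<open>The definition selects an unspecified lift; it differs from \<open>F\<close> by
    \<open>r k\<close>, which shifts the limit by the integer \<open>k\<close>.\<close>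
  define F' where "F' = (SOME F'. is_lift r (proj F) F')"
  have "is_lift r (proj F) F'"
    unfolding F'_def using someI[of "is_lift r (proj F)", OF proj_is_lift[OF F]] .
  then obtain k :: int where "\<And>x. F' x = F x + real r * of_int k"
    using lifts_differ_by_period[OF r(2) proj_is_lift[OF F]] by blast
  then have "F' = (\<lambda>x. F x + real r * of_int k)"
    by auto
  then have F'n: "(F' ^^ n) 0 = (F ^^ n) 0 + real r * of_int (k * int n)" for n
    by (simp add: funpow_add_const[OF F])
  \<comment> \<open>The sum bounds the iterates at all remainders below \<open>q\<close>; the last
    term bounds the contribution of the fractional part of n / q.\<close>
  define C where "C = (\<Sum>j<q. \<bar>(F ^^ j) 0\<bar>) + \<bar>real r * of_int p\<bar>"
  define L where "L = of_int p / real q + of_int k"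
  have bound: "\<bar>(F ^^ n) 0 - real r * (of_int p / real q) * real n\<bar> \<le> C" for n
  proof -
    have "(F ^^ n) 0 = (F ^^ (q * (n div q))) ((F ^^ (n mod q)) 0)"
      by (metis funpow_add comp_apply mult_div_mod_eq)
    also have "\<dots> = (F ^^ (n mod q)) 0 + real r * of_int (p * int (n div q))"
      using funpow_mult_translation[OF Fq] by simp
    finally have 1: "(F ^^ n) 0 = (F ^^ (n mod q)) 0 + real r * of_int p * real (n div q)"
      by simp
    have "real n = real q * real (n div q) + real (n mod q)"
      by (metis mult_div_mod_eq of_nat_add of_nat_mult)
    then have "real n / real q = real (n div q) + real (n mod q) / real q"
      using \<open>q > 0\<close> by (simp add: field_simps)
    moreover have "real r * (of_int p / real q) * real n = real r * of_int p * (real n / real q)"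
      by simp
    ultimately have 2: "real r * (of_int p / real q) * real n =
        real r * of_int p * real (n div q) + real r * of_int p * (real (n mod q) / real q)"
      by (simp add: algebra_simps)
    have "\<bar>(F ^^ (n mod q)) 0\<bar> \<le> (\<Sum>j<q. \<bar>(F ^^ j) 0\<bar>)"
      using \<open>q > 0\<close> by (intro member_le_sum) auto
    moreover have "\<bar>real r * of_int p * (real (n mod q) / real q)\<bar> \<le> \<bar>real r * of_int p\<bar> * 1"
      unfolding abs_mult[of "real r * of_int p"]
      using \<open>q > 0\<close> by (intro mult_left_mono) (auto simp: less_imp_le)
    ultimately show ?thesis
      unfolding 1 2 C_def by linarith
  qed
  have "(\<lambda>n. (F' ^^ n) 0 / (real r * real n)) \<longlonglongrightarrow> L"
  proof (rule LIM_zero_cancel, rule Lim_null_comparison)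
    show "\<forall>\<^sub>F n in sequentially. norm ((F' ^^ n) 0 / (real r * real n) - L) \<le> (C / real r) * inverse (real n)"
    proof (rule eventually_sequentiallyI[of 1])
      fix n :: nat assume n: "n \<ge> 1"
      have "(F' ^^ n) 0 / (real r * real n) - L =
          ((F ^^ n) 0 - real r * (of_int p / real q) * real n) / (real r * real n)"
        unfolding F'n L_def using n r by (simp add: field_simps)
      also have "norm \<dots> \<le> C / (real r * real n)"
        using bound[of n] n r by (simp add: divide_right_mono)
      finally show "norm ((F' ^^ n) 0 / (real r * real n) - L) \<le> (C / real r) * inverse (real n)"
        by (simp add: field_simps)
    qed
    show "(\<lambda>n. (C / real r) * inverse (real n)) \<longlonglongrightarrow> 0"
      by (intro tendsto_mult_right_zero lim_inverse_n)
  qed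
  then have "rotation_number r (proj F) = circle_pt 1 L"
    unfolding rotation_number_def F'_def[symmetric] Let_def by (simp add: limI)
  also have "\<dots> = circle_pt 1 (of_int p / real q)"
    unfolding circle_pt_eq_iff L_def by (intro exI[of _ "- k"]) simp
  finally show ?thesis .
qed

end

section \<open>Elements of finite order\<close>

locale brown_thompson_torsion = brown_thompson +
  fixes q :: nat
  assumes q_ge_2: "q \<ge> 2"
begin

text \<open>Normalised lifts of the elements of order \<open>q\<close> and rotation number 1 / q:
  the q-th iterate is exactly one period.\<close>

definition roots :: "(real \<Rightarrow> real) set" where
  "roots = {G \<in> lifts. \<forall>x. (G ^^ q) x = x + real r}"

text \<open>The possible values of the conjugacy invariant, as least residues; for m = 2 the modulus
  is 1 and only 0 remains.\<close>

definition Sol :: "nat set" where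
  "Sol = {b. b < m - 1 \<and> [q * b = r] (mod (m - 1))}"

section \<open>Classification of the roots up to conjugacy\<close>

lemma zcong_of_nat_iff: "zcong (real a) (real b) \<longleftrightarrow> [a = b] (mod (m - 1))"
  using zcong_of_int_iff[of "int a" "int b"] by (simp add: cong_iff_dvd_diff flip: cong_int_iff)

lemma roots_funpow: "G \<in> roots \<Longrightarrow> (G ^^ (q * n)) x = x + real r * real n"
  using funpow_mult_translation[where F = G and q = q and k = 1 and n = n] by (simp add: roots_def)

text \<open>By \<open>PLM_zcong\<close> every application of \<open>G\<close> adds the class of
  \<open>G 0\<close>; after \<open>q\<close> applications the total is \<open>r\<close>.\<close>

lemma roots_invariant:
  assumes G: "G \<in> roots"
  shows "\<exists>b\<in>Sol. zcong (G 0) (real b)"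
proof -
  have PLM: "G \<in> PLM"
    using G by (simp add: roots_def lifts_PLM)
  have iter: "zcong ((G ^^ n) 0) (real n * G 0)" for n
  proof (induction n)
    case (Suc n)
    have "zcong (G ((G ^^ n) 0) - G 0) ((G ^^ n) 0 - 0)"
      using PLM PLM_Z_inv[OF PLM_funpow[OF PLM]] by (intro PLM_zcong) auto
    then have "zcong (G ((G ^^ n) 0) - G 0) (real n * G 0)"
      using Suc zcong_trans by simp
    from zcong_add[OF this zcong_refl[of "G 0"]] show ?case
      by (simp add: algebra_simps)
  qed simp
  have "zcong (real r) (real q * G 0)"
    using iter[of q] G by (simp add: roots_def)
  moreover obtain n where n: "zcong (G 0) (of_int n)"
    using zcong_of_int_ex PLM_Z_inv[OF PLM] by fastforce
  define b where "b = nat (n mod int (m - 1))"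
  have m1: "int (m - 1) > 0"
    using m_ge_2 by simp
  have b: "int b = n mod int (m - 1)"
    using m1 by (simp add: b_def)
  then have "int (m - 1) dvd n - int b"
    by (simp add: mod_eq_dvd_iff)
  then have "zcong (of_int n) (real b)"
    using zcong_of_int_iff[of n "int b"] by simp
  then have Gb: "zcong (G 0) (real b)"
    using n zcong_trans by blast
  then have "zcong (real q * G 0) (real q * real b)"
    by (intro zcong_mult) auto
  ultimately have "zcong (real (q * b)) (real r)"
    using zcong_trans zcong_sym by (metis of_nat_mult)
  then have "[q * b = r] (mod (m - 1))"
    by (simp only: zcong_of_nat_iff)
  moreover have "int b < int (m - 1)"
    unfolding b using m1 by simp
  ultimately have "b \<in> Sol"
    by (simp add: Sol_def)
  with Gb show ?thesis by blast
qed

text \<open>The translation by \<open>L\<close> is a q-th root of the translation by q L.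
  Conjugating the latter to the translation by \<open>r\<close> turns the former into the desired
  root.\<close>

lemma roots_ex:
  assumes b: "b \<in> Sol"
  shows "\<exists>G\<in>roots. zcong (G 0) (real b)"
proof -
  \<comment> \<open>Adding m - 1 keeps the residue and makes the length positive even for b =
    0.\<close>
  define L where "L = real (b + (m - 1))"
  have L: "L \<in> Z_inv m" "L > 0"
    unfolding L_def using m_ge_2 by (simp_all only: Z_inv_of_nat of_nat_0_less_iff)
  have "zcong L (real b)"
    unfolding L_def zcong_of_nat_iff by (simp add: cong_def)
  have "zcong (real q * L) (real q * real b)"
    using \<open>zcong L (real b)\<close> by (intro zcong_mult) auto
  moreover have "zcong (real (q * b)) (real r)"
    using b unfolding zcong_of_nat_iff Sol_def by simp
  ultimately have "zcong (real r) (real q * L)"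
    using zcong_trans zcong_sym by (metis of_nat_mult)
  moreover have "(\<lambda>x. x + real r) \<in> PLM"
    by (intro PLM_translation) simp
  \<comment> \<open>Here \<open>straighten\<close> is applied to the translation by \<open>r\<close>
    itself, with exponent 1 and step q L.\<close>
  ultimately obtain \<Psi> where \<Psi>: "\<Psi> \<in> PLM" "\<And>x. \<Psi> (x + real q * L) = \<Psi> x + real r" "\<Psi> 0 = 0"
    using L r_ge_1 q_ge_2 by (elim straighten[of "\<lambda>x. x + real r" 1 "real r" "real q * L"]) auto
  define G where "G = \<Psi> \<circ> ((\<lambda>x. x + L) \<circ> inv_into UNIV \<Psi>)"
  have "G \<in> PLM"
    unfolding G_def using \<Psi>(1) L by (intro PLM_comp PLM_inv PLM_translation)
  have iter: "(G ^^ n) (\<Psi> y) = \<Psi> (y + real n * L)" for n y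
  proof (induction n)
    case (Suc n)
    then show ?case
      using \<Psi>(1) by (simp add: G_def algebra_simps)
  qed simp
  have Gq: "(G ^^ q) x = x + real r" for x
    using iter[of q "inv_into UNIV \<Psi> x"] \<Psi> by simp
  \<comment> \<open>\<open>G\<close> commutes with its own q-th iterate, the translation by
    \<open>r\<close>.\<close>
  have "G (x + real r) = G x + real r" for x
    using funpow_swap1[of G q x] by (simp add: Gq)
  then have "G \<in> roots"
    using \<open>G \<in> PLM\<close> Gq by (simp add: roots_def lifts_def)
  moreover have "zcong (G 0) L"
    using PLM_zcong[OF \<Psi>(1), of 0 L] L iter[of 1 0] \<Psi>(3) by simp
  ultimately show ?thesis
    using \<open>zcong L (real b)\<close> zcong_trans by blast
qed

text \<open>Both roots are straightened to the translation by the same \<open>L\<close>; the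
  conjugator is one straightening map composed with the inverse of the other.\<close>

lemma roots_conjugate:
  assumes G: "G \<in> roots" and G': "G' \<in> roots" and cong: "zcong (G 0) (G' 0)"
  shows "\<exists>H\<in>lifts. \<forall>x. H (G x) = G' (H x)"
proof -
  obtain b where b: "zcong (G 0) (real b)"
    using roots_invariant[OF G] by blast
  define L where "L = real (b + (m - 1))"
  have L: "L \<in> Z_inv m" "L > 0"
    unfolding L_def using m_ge_2 by (simp_all only: Z_inv_of_nat of_nat_0_less_iff)
  have "zcong (real b) L"
    unfolding L_def zcong_of_nat_iff by (simp add: cong_def)
  then have GL: "zcong (G 0) L" "zcong (G' 0) L"
    using b cong zcong_trans zcong_sym by blast+
  have PLM: "G \<in> PLM" "G' \<in> PLM"
    using G G' by (simp_all add: roots_def lifts_PLM)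
  have r: "real r > 0"
    using r_ge_1 by simp
  have Gq: "\<And>x. (G ^^ q) x = x + real r" "\<And>x. (G' ^^ q) x = x + real r"
    using G G' by (simp_all add: roots_def)
  obtain \<Psi> where \<Psi>: "\<Psi> \<in> PLM" "\<And>x. \<Psi> (x + L) = G (\<Psi> x)"
    using straighten[OF PLM(1) Gq(1) r L GL(1)] by metis
  obtain \<Psi>' where \<Psi>': "\<Psi>' \<in> PLM" "\<And>x. \<Psi>' (x + L) = G' (\<Psi>' x)"
    using straighten[OF PLM(2) Gq(2) r L GL(2)] by metis
  define H where "H = \<Psi>' \<circ> inv_into UNIV \<Psi>"
  have "H \<in> PLM"
    unfolding H_def using \<Psi>(1) \<Psi>'(1) by (intro PLM_comp PLM_inv)
  have HG: "H (G x) = G' (H x)" for x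
  proof -
    define y where "y = inv_into UNIV \<Psi> x"
    have "G x = \<Psi> (y + L)"
      using \<Psi> by (simp add: y_def)
    then have "inv_into UNIV \<Psi> (G x) = y + L"
      using \<Psi>(1) by simp
    then show ?thesis
      using \<Psi>' by (simp add: H_def y_def)
  qed
  \<comment> \<open>\<open>H\<close> also intertwines the q-th iterates, both translations by
    \<open>r\<close>, so it has period \<open>r\<close>.\<close>
  have "H ((G ^^ n) x) = (G' ^^ n) (H x)" for n x
    by (induction n) (simp_all add: HG)
  from this[of q] have "H (x + real r) = H x + real r" for x
    by (simp add: Gq)
  then have "H \<in> lifts"
    using \<open>H \<in> PLM\<close> by (simp add: lifts_def)
  with HG show ?thesis by blast
qed

text \<open>The common value H (G 0) = G' (H 0) exceeds \<open>H 0\<close> by the class of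
  \<open>G 0\<close> when read through \<open>H\<close>, and by that of \<open>G' 0\<close> when
  read through \<open>G'\<close>.\<close>

lemma conjugate_roots_zcong:
  assumes "G \<in> roots" "G' \<in> roots" "H \<in> lifts" "\<And>x. H (G x) = G' (H x)"
  shows "zcong (G 0) (G' 0)"
proof -
  have PLM: "G \<in> PLM" "G' \<in> PLM" "H \<in> PLM"
    using assms by (simp_all add: roots_def lifts_PLM)
  have "zcong (H (G 0) - H 0) (G 0 - 0)"
    using PLM PLM_Z_inv by (intro PLM_zcong) auto
  then have *: "zcong (G' (H 0) - H 0) (G 0)"
    by (simp add: assms(4))
  have "zcong (G' (H 0) - G' 0) (H 0 - 0)"
    using PLM PLM_Z_inv by (intro PLM_zcong) auto
  then have "zcong (G' (H 0) - G' 0 + (G' 0 - H 0)) (H 0 - 0 + (G' 0 - H 0))"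
    by (intro zcong_add) auto
  then have "zcong (G' (H 0) - H 0) (G' 0)"
    by simp
  with * show ?thesis
    using zcong_trans zcong_sym by blast
qed

text \<open>The n-th power is trivial exactly when the iterate \<open>G ^^ (p * n)\<close> is a
  translation by a multiple of \<open>r\<close>, that is, when \<open>q\<close> divides p n.\<close>

lemma proj_root_power_order:
  assumes G: "G \<in> roots" and p: "coprime p q"
  shows "proj (G ^^ p) \<in> elements_of_order T q"
    and "rotation_number r (proj (G ^^ p)) = circle_pt 1 (of_int (int p) / real q)"
proof -
  interpret group T by (rule group_T)
  have lifts: "G ^^ n \<in> lifts" for n
    using G lifts_funpow by (simp add: roots_def)
  have carr: "proj (G ^^ p) \<in> carrier T"
    using lifts by (simp add: carrier_T)
  have "proj (G ^^ p) [^]\<^bsub>T\<^esub> n = \<one>\<^bsub>T\<^esub> \<longleftrightarrow> q dvd n" for n :: nat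
  proof -
    have "proj (G ^^ p) [^]\<^bsub>T\<^esub> n = \<one>\<^bsub>T\<^esub> \<longleftrightarrow> proj id = proj (G ^^ (p * n))"
      using pow_T[OF lifts] by (auto simp: one_T funpow_mult)
    also have "\<dots> \<longleftrightarrow> (\<exists>k::int. \<forall>x. (G ^^ (p * n)) x = x + real r * of_int k)"
      using proj_eq_iff[OF id_lifts lifts] by simp
    also have "\<dots> \<longleftrightarrow> q dvd n"
    proof
      assume "\<exists>k::int. \<forall>x. (G ^^ (p * n)) x = x + real r * of_int k"
      then obtain k :: int where k: "\<And>x. (G ^^ (p * n)) x = x + real r * of_int k"
        by blast
      \<comment> \<open>Computing the same iterate at 0 in two ways gives k q = p n.\<close>
      have "(G ^^ (p * n * q)) 0 = real r * of_int (k * int q)"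
        using funpow_mult_translation[OF k, of q 0] by simp
      moreover have "(G ^^ (p * n * q)) 0 = real r * real (p * n)"
        using roots_funpow[OF G, of "p * n" 0] by (simp add: ac_simps)
      ultimately have "of_int (k * int q) = (of_int (int (p * n)) :: real)"
        using r_ge_1 by simp
      then have "k * int q = int (p * n)"
        by linarith
      then have "q dvd p * n"
        by (metis dvd_triv_right of_nat_dvd_iff)
      then show "q dvd n"
        using p by (metis coprime_commute coprime_dvd_mult_right_iff)
    next
      assume "q dvd n"
      then obtain j where "n = q * j" ..
      then have "(G ^^ (p * n)) x = x + real r * of_int (int (p * j))" for x
        using roots_funpow[OF G, of "p * j" x] by (simp add: ac_simps)
      then show "\<exists>k::int. \<forall>x. (G ^^ (p * n)) x = x + real r * of_int k"
        by blast
    qed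
    finally show ?thesis .
  qed
  then show "proj (G ^^ p) \<in> elements_of_order T q"
    using carr by (simp add: elements_of_order_def ord_unique)
  have "((G ^^ p) ^^ q) x = x + real r * of_int (int p)" for x
    using roots_funpow[OF G, of p x] by (simp add: funpow_mult mult.commute)
  then show "rotation_number r (proj (G ^^ p)) = circle_pt 1 (of_int (int p) / real q)"
    using q_ge_2 by (intro rotation_number_proj lifts) auto
qed

text \<open>A lift \<open>F\<close> with \<open>F ^^ q\<close> the translation by \<open>r p\<close> is, up to a multiple of the period,
  the \<open>p\<close>-th power of \<open>F ^^ j\<close>, where \<open>j\<close> inverts \<open>p\<close> modulo \<open>q\<close>.\<close>

lemma order_imp_root_power:
  assumes f: "f \<in> elements_of_order T q"
  shows "\<exists>p\<in>totatives q. \<exists>G\<in>roots. f = proj (G ^^ p)"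
proof -
  interpret group T by (rule group_T)
  have q: "q > 0"
    using q_ge_2 by simp
  have fc: "f \<in> carrier T" and ord: "ord f = q"
    using f by (simp_all add: elements_of_order_def)
  obtain F where F: "F \<in> lifts" "f = proj F"
    using fc by (auto simp: carrier_T)
  have "f [^]\<^bsub>T\<^esub> q = \<one>\<^bsub>T\<^esub>"
    using fc ord pow_ord_eq_1 by metis
  then have "proj id = proj (F ^^ q)"
    using F by (simp add: pow_T one_T)
  then obtain k :: int where k: "\<And>x. (F ^^ q) x = x + real r * of_int k"
    using proj_eq_iff[OF id_lifts lifts_funpow[OF F(1)]] by auto
  \<comment> \<open>Changing the lift by \<open>i\<close> periods changes \<open>k\<close> by i q.
    The shift by one puts the residue \<open>p\<close> between 1 and \<open>q\<close> rather than
    between 0 and q - 1.\<close>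
  define i where "i = - ((k - 1) div int q)"
  define p where "p = nat ((k - 1) mod int q + 1)"
  have p_int: "int p = k + i * int q"
  proof -
    have "(k - 1) mod int q = k - 1 + i * int q"
      by (simp add: i_def minus_div_mult_eq_mod [symmetric])
    moreover have "(k - 1) mod int q \<ge> 0"
      using q by simp
    ultimately show ?thesis
      by (simp add: p_def)
  qed
  have p_range: "0 < p" "p \<le> q"
  proof -
    have "0 \<le> (k - 1) mod int q" "(k - 1) mod int q < int q"
      using q by auto
    then show "0 < p" "p \<le> q"
      unfolding p_def by linarith+
  qed
  define F0 where "F0 = (\<lambda>x. F x + real r * of_int i)"
  have F0: "F0 \<in> lifts"
    unfolding F0_def using F lifts_add by blast
  have f_eq: "f = proj F0"
    using F F0 by (simp add: proj_eq_iff) (auto simp: F0_def)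
  have F0q: "(F0 ^^ q) x = x + real r * of_int (int p)" for x
    unfolding F0_def funpow_add_const[OF F(1)] k p_int by (simp add: algebra_simps)
  \<comment> \<open>A common divisor \<open>d\<close> would make the d-th iterate of
    \<open>K\<close> the identity, hence \<open>K\<close> itself; then \<open>f\<close> would
    already have order dividing q / d.\<close>
  define d where "d = gcd p q"
  have d: "d > 0" "p div d * d = p" "q div d * d = q"
    using q by (auto simp: d_def)
  define K where "K = (\<lambda>x. (F0 ^^ (q div d)) x + real r * of_int (- int (p div d)))"
  have "K \<in> lifts"
    unfolding K_def by (intro lifts_add lifts_funpow F0)
  have "(K ^^ d) x = x" for x
  proof -
    have "(K ^^ d) x = (F0 ^^ (q div d * d)) x + real r * of_int (- int (p div d) * int d)"
      unfolding K_def by (subst funpow_add_const) (auto simp: funpow_mult intro: lifts_funpow F0)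
    also have "int (p div d) * int d = int p"
      using d by (metis of_nat_mult)
    then have "- int (p div d) * int d = - int p"
      by simp
    finally show ?thesis
      unfolding d(3) F0q by simp
  qed
  then have "K x = x" for x
    using lifts_strict_mono[OF \<open>K \<in> lifts\<close>] d by (intro strict_mono_funpow_fixed[of K d]) auto
  then have "(F0 ^^ (q div d)) x = id x + real r * of_int (int (p div d))" for x
    by (simp add: K_def) (metis add.commute diff_add_cancel)
  then have "proj id = proj (F0 ^^ (q div d))"
    using proj_eq_iff[OF id_lifts lifts_funpow[OF F0]] by blast
  then have "f [^]\<^bsub>T\<^esub> (q div d) = \<one>\<^bsub>T\<^esub>"
    using F0 by (simp add: f_eq pow_T one_T)
  then have "q dvd q div d"
    using fc ord by (simp add: pow_eq_id)
  then have "q \<le> q div d"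
    using d(3) q by (intro dvd_imp_le) (metis gr0I mult_0)+
  then have "d = 1"
  proof -
    have "q div d < q" if "1 < d"
      using that q by (rule div_less_dividend)
    then show ?thesis
      using d(1) \<open>q \<le> q div d\<close> by linarith
  qed
  then have cop: "coprime p q"
    by (simp add: d_def coprime_iff_gcd_eq_1)
  then have "p \<in> totatives q"
    using p_range by (simp add: totatives_def)
  obtain j l where jl: "p * j = 1 + l * q"
    using inverse_mod_eq[OF cop q_ge_2] .
  define G where "G = (\<lambda>x. (F0 ^^ j) x + real r * of_int (- int l))"
  have G_lift: "G \<in> lifts"
    unfolding G_def by (intro lifts_add lifts_funpow F0)
  have Gn: "(G ^^ n) x = (F0 ^^ (j * n)) x + real r * of_int (- int l * int n)" for n x
    unfolding G_def by (subst funpow_add_const) (auto simp: funpow_mult intro: lifts_funpow F0)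
  have F0qn: "(F0 ^^ (q * n)) x = x + real r * of_int (int p * int n)" for n x
    using funpow_mult_translation[OF F0q] .
  have "(G ^^ q) x = x + real r" for x
  proof -
    have "(G ^^ q) x = x + real r * of_int (int (p * j) - int (l * q))"
      unfolding Gn mult.commute[of j q] F0qn by (simp add: algebra_simps)
    then show ?thesis
      by (simp add: jl)
  qed
  then have "G \<in> roots"
    using G_lift by (simp add: roots_def)
  moreover have "(G ^^ p) x = F0 x" for x
  proof -
    have "j * p = 1 + q * l"
      using jl by (simp add: mult.commute)
    then have "(F0 ^^ (j * p)) x = F0 ((F0 ^^ (q * l)) x)"
      by simp
    also have "\<dots> = F0 x + real r * of_int (int p * int l)"
      unfolding F0qn lifts_add_int[OF F0] ..
    finally show ?thesis
      unfolding Gn by simp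
  qed
  then have "G ^^ p = F0"
    by auto
  ultimately show ?thesis
    using \<open>p \<in> totatives q\<close> f_eq by blast
qed

text \<open>The conjugation lifts up to a translation by \<open>r k\<close>. Comparing q-th iterates
  gives p' = p + k q, so p = p' and k = 0; the exact conjugation of p-th powers then yields one of
  the roots.\<close>

lemma conjugate_root_powers:
  assumes G: "G \<in> roots" and G': "G' \<in> roots" and p: "p \<in> totatives q" and p': "p' \<in> totatives q"
    and h: "h \<in> carrier T" and conj: "h \<otimes>\<^bsub>T\<^esub> proj (G ^^ p) = proj (G' ^^ p') \<otimes>\<^bsub>T\<^esub> h"
  shows "p = p'" "zcong (G 0) (G' 0)"
proof -
  obtain H where H: "H \<in> lifts" "h = proj H"
    using h by (auto simp: carrier_T)
  have lifts: "G ^^ n \<in> lifts" "G' ^^ n \<in> lifts" for n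
    using G G' lifts_funpow by (simp_all add: roots_def)
  have "proj (H \<circ> G ^^ p) = proj (G' ^^ p' \<circ> H)"
    using conj H lifts by (simp add: mult_T)
  then obtain k :: int where k: "\<And>x. (G' ^^ p') (H x) = H ((G ^^ p) x) + real r * of_int k"
    using proj_eq_iff[OF lifts_comp[OF lifts(1) H(1)] lifts_comp[OF H(1) lifts(2)]] by auto
  have iter: "((G' ^^ p') ^^ n) (H x) = H (((G ^^ p) ^^ n) x) + real r * of_int (k * int n)" for n x
  proof (induction n)
    case (Suc n)
    show ?case
      using Suc k[of "((G ^^ p) ^^ n) x"]
        lifts_add_int[OF lifts(2)[of p'], of "H (((G ^^ p) ^^ n) x)" "k * int n"]
      by (simp add: algebra_simps)
  qed simp
  have "H 0 + real r * real p' = H (real r * real p) + real r * of_int (k * int q)"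
    using iter[of q 0] roots_funpow[OF G', of p' "H 0"] roots_funpow[OF G, of p 0]
    by (simp add: funpow_mult mult.commute)
  also have "H (real r * real p) = H 0 + real r * real p"
    using lifts_add_int[OF H(1), of 0 "int p"] by simp
  finally have "real r * real p' = real r * (real p + of_int (k * int q))"
    by (simp add: algebra_simps)
  then have "real p' = real p + of_int (k * int q)"
    using r_ge_1 by simp
  then have p'_eq: "int p' = int p + k * int q"
    by linarith
  with p p' show "p = p'"
    by (intro congruent_in_interval_unique[of p q p' k]) (auto simp: totatives_def)
  then have "k = 0"
    using p'_eq q_ge_2 by simp
  have "coprime p q"
    using p by (simp add: totatives_def)
  then obtain j l where jl: "p * j = 1 + l * q"
    using inverse_mod_eq q_ge_2 by blast
  \<comment> \<open>Since p j = 1 + l q, the j-th iterate of the p-th power recovers a root up to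
    the same translation for \<open>G\<close> and \<open>G'\<close>.\<close>
  have root: "(A ^^ (p * j)) x = A x + real r * of_int (int l)" if A: "A \<in> roots" for A x
  proof -
    have "(A ^^ (p * j)) x = A ((A ^^ (q * l)) x)"
      unfolding jl by (simp add: mult.commute)
    also have "\<dots> = A (x + real r * of_int (int l))"
      using roots_funpow[OF A] by simp
    also have "\<dots> = A x + real r * of_int (int l)"
      using A by (intro lifts_add_int) (simp add: roots_def)
    finally show ?thesis .
  qed
  have "H (G x) = G' (H x)" for x
  proof -
    have "(G' ^^ (p * j)) (H x) = H ((G ^^ (p * j)) x)"
      using iter[of j x] \<open>k = 0\<close> \<open>p = p'\<close> by (simp add: funpow_mult)
    then show ?thesis
      by (simp add: root[OF G] root[OF G'] lifts_add_int[OF H(1), of _ "int l", simplified])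
  qed
  with G G' H show "zcong (G 0) (G' 0)"
    by (intro conjugate_roots_zcong)
qed

section \<open>Counting the conjugacy classes\<close>

definition root_of :: "nat \<Rightarrow> real \<Rightarrow> real" where
  "root_of b = (SOME G. G \<in> roots \<and> zcong (G 0) (real b))"

lemma root_of: "b \<in> Sol \<Longrightarrow> root_of b \<in> roots \<and> zcong (root_of b 0) (real b)"
proof -
  assume "b \<in> Sol"
  then have "\<exists>G. G \<in> roots \<and> zcong (G 0) (real b)"
    using roots_ex by blast
  from someI_ex[OF this] show ?thesis
    unfolding root_of_def .
qed

abbreviation conj_class where
  "conj_class \<equiv> orbit T (\<lambda>g. \<lambda>h \<in> carrier T. g \<otimes>\<^bsub>T\<^esub> h \<otimes>\<^bsub>T\<^esub> inv\<^bsub>T\<^esub> g)"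

text \<open>The exponent and the residue are both conjugacy invariants by
  \<open>conjugate_root_powers\<close>; congruent residues below m - 1 coincide.\<close>

lemma conj_class_inj:
  "inj_on (\<lambda>(p, b). conj_class (proj (root_of b ^^ p))) (totatives q \<times> Sol)"
proof (rule inj_onI, clarify)
  interpret group T by (rule group_T)
  fix p b p' b'
  assume p: "p \<in> totatives q" "p' \<in> totatives q" and b: "b \<in> Sol" "b' \<in> Sol"
    and eq: "conj_class (proj (root_of b ^^ p)) = conj_class (proj (root_of b' ^^ p'))"
  note rt = root_of[OF b(1)] root_of[OF b(2)]
  have "proj (root_of b ^^ p) \<in> carrier T" "proj (root_of b' ^^ p') \<in> carrier T"
    using rt lifts_funpow by (auto simp: carrier_T roots_def)
  with eq obtain h where h: "h \<in> carrier T"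
      "h \<otimes>\<^bsub>T\<^esub> proj (root_of b ^^ p) = proj (root_of b' ^^ p') \<otimes>\<^bsub>T\<^esub> h"
    using conjugacy_orbit_eq_iff by blast
  have "p = p'" "zcong (root_of b 0) (root_of b' 0)"
    using conjugate_root_powers[OF _ _ p h] rt by auto
  then have "zcong (real b) (real b')"
    using rt zcong_trans zcong_sym by blast
  then have "b = b'"
    using b unfolding zcong_of_nat_iff by (simp add: Sol_def cong_def)
  with \<open>p = p'\<close> show "p = p' \<and> b = b'"
    by simp
qed

text \<open>A conjugator from the root \<open>G\<close> to the representative with the same
  invariant also conjugates their p-th powers.\<close>

lemma conj_class_root_power:
  assumes f: "f \<in> elements_of_order T q"
  shows "\<exists>p\<in>totatives q. \<exists>b\<in>Sol. conj_class f = conj_class (proj (root_of b ^^ p)) \<and>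
    rotation_number r f = circle_pt 1 (of_int (int p) / real q)"
proof -
  interpret group T by (rule group_T)
  obtain p G where p: "p \<in> totatives q" and G: "G \<in> roots" and f_eq: "f = proj (G ^^ p)"
    using order_imp_root_power[OF f] by blast
  obtain b where b: "b \<in> Sol" "zcong (G 0) (real b)"
    using roots_invariant[OF G] by blast
  note rt = root_of[OF b(1)]
  have "zcong (G 0) (root_of b 0)"
    using b rt zcong_trans zcong_sym by blast
  then obtain H where H: "H \<in> lifts" "\<And>x. H (G x) = root_of b (H x)"
    using roots_conjugate[OF G] rt by blast
  have "H ((G ^^ n) x) = (root_of b ^^ n) (H x)" for n x
    by (induction n) (simp_all add: H(2))
  then have "H \<circ> G ^^ p = root_of b ^^ p \<circ> H"
    by auto
  moreover have lifts: "G ^^ p \<in> lifts" "root_of b ^^ p \<in> lifts"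
    using G rt lifts_funpow by (auto simp: roots_def)
  ultimately have "proj H \<otimes>\<^bsub>T\<^esub> f = proj (root_of b ^^ p) \<otimes>\<^bsub>T\<^esub> proj H"
    using H by (simp add: f_eq mult_T)
  moreover have "f \<in> carrier T" "proj (root_of b ^^ p) \<in> carrier T" "proj H \<in> carrier T"
    using lifts H by (simp_all add: f_eq carrier_T)
  ultimately have "conj_class f = conj_class (proj (root_of b ^^ p))"
    using conjugacy_orbit_eq_iff by blast
  moreover have "rotation_number r f = circle_pt 1 (of_int (int p) / real q)"
    unfolding f_eq using p G by (intro proj_root_power_order) (auto simp: totatives_def)
  ultimately show ?thesis
    using p b by blast
qed

text \<open>A set \<open>P\<close> of numerators treats both counts at once: all totatives for the
  elements of order \<open>q\<close>, a singleton for a prescribed rotation number.\<close>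

lemma conjugacy_classes_rotation_numbers:
  assumes P: "P \<subseteq> totatives q"
  defines "E \<equiv> {f \<in> elements_of_order T q.
    \<exists>p\<in>P. rotation_number r f = circle_pt 1 (of_int (int p) / real q)}"
  shows "finite (conjugacy_classes T E)" "card (conjugacy_classes T E) = card P * card Sol"
proof -
  have q: "q > 0"
    using q_ge_2 by simp
  have "conjugacy_classes T E = conj_class ` E"
    by (auto simp: conjugacy_classes_def orbits_def)
  also have "\<dots> = (\<lambda>(p, b). conj_class (proj (root_of b ^^ p))) ` (P \<times> Sol)"
  proof (intro equalityI subsetI)
    fix c assume "c \<in> conj_class ` E"
    then obtain f p' where f: "f \<in> elements_of_order T q" "c = conj_class f" "p' \<in> P"
        "rotation_number r f = circle_pt 1 (of_int (int p') / real q)"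
      by (auto simp: E_def)
    obtain p b where pb: "p \<in> totatives q" "b \<in> Sol" "conj_class f = conj_class (proj (root_of b ^^ p))"
        "rotation_number r f = circle_pt 1 (of_int (int p) / real q)"
      using conj_class_root_power[OF f(1)] by blast
    \<comment> \<open>The exponent of the representative is matched with the prescribed numerator
      through the rotation number.\<close>
    have "\<exists>k. int p' = int p + k * int q"
      unfolding circle_pt_1_eq_iff[OF q, symmetric] f(4)[symmetric] pb(4)[symmetric] ..
    then have "p = p'"
      using congruent_in_interval_unique[of p q p'] pb(1) f(3) P by (auto simp: totatives_def)
    then show "c \<in> (\<lambda>(p, b). conj_class (proj (root_of b ^^ p))) ` (P \<times> Sol)"
      using f pb by force
  next
    fix c assume "c \<in> (\<lambda>(p, b). conj_class (proj (root_of b ^^ p))) ` (P \<times> Sol)"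
    then obtain p b where pb: "p \<in> P" "b \<in> Sol" "c = conj_class (proj (root_of b ^^ p))"
      by auto
    then have "proj (root_of b ^^ p) \<in> E"
      unfolding E_def using proj_root_power_order[of "root_of b" p] root_of[OF pb(2)] P
      by (auto simp: totatives_def)
    then show "c \<in> conj_class ` E"
      using pb by blast
  qed
  finally have eq: "conjugacy_classes T E =
      (\<lambda>(p, b). conj_class (proj (root_of b ^^ p))) ` (P \<times> Sol)" .
  have fin: "finite P" "finite Sol"
    using P finite_subset[OF _ finite_totatives] by (auto simp: Sol_def)
  show "finite (conjugacy_classes T E)"
    unfolding eq using fin by simp
  have "inj_on (\<lambda>(p, b). conj_class (proj (root_of b ^^ p))) (P \<times> Sol)"
    by (rule inj_on_subset[OF conj_class_inj]) (use P in auto)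
  then show "card (conjugacy_classes T E) = card P * card Sol"
    unfolding eq by (subst card_image) (auto simp: card_cartesian_product)
qed

lemma card_Sol: "card Sol = (if gcd (m - 1) q dvd r then gcd (m - 1) q else 0)"
  unfolding Sol_def using m_ge_2 by (intro card_linear_cong) simp

lemma conjugacy_classes_order:
  "finite (conjugacy_classes T (elements_of_order T q))"
  "card (conjugacy_classes T (elements_of_order T q)) = totient q * card Sol"
proof -
  have "elements_of_order T q = {f \<in> elements_of_order T q.
      \<exists>p\<in>totatives q. rotation_number r f = circle_pt 1 (of_int (int p) / real q)}"
    using conj_class_root_power by blast
  then show "finite (conjugacy_classes T (elements_of_order T q))"
    "card (conjugacy_classes T (elements_of_order T q)) = totient q * card Sol"
    using conjugacy_classes_rotation_numbers[of "totatives q"] by (simp_all add: totient_def)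
qed

lemma conjugacy_classes_rotation_number:
  fixes p :: int
  assumes "coprime p (int q)"
  defines "E \<equiv> {f \<in> elements_of_order T q. rotation_number r f = circle_pt 1 (of_int p / real q)}"
  shows "finite (conjugacy_classes T E)" "card (conjugacy_classes T E) = card Sol"
proof -
  have q: "q > 0"
    using q_ge_2 by simp
  define p' where "p' = nat (p mod int q)"
  have p': "int p' = p mod int q"
    using q by (simp add: p'_def)
  have cop: "coprime p' q"
    using assms(1) q_ge_2 by (metis coprime_int_iff coprime_mod_left_iff p' of_nat_eq_0_iff
      not_numeral_le_zero)
  have "p' < q"
    using p' q by (metis of_nat_0_less_iff of_nat_less_iff pos_mod_bound)
  \<comment> \<open>A zero remainder would not be coprime to \<open>q\<close>, as q is at least
    2.\<close>
  moreover have "p' \<noteq> 0"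
    using cop q_ge_2 by (intro notI) simp
  ultimately have tot: "p' \<in> totatives q"
    using cop by (simp add: totatives_def)
  have "int p' = p + - (p div int q) * int q"
    unfolding p' by (simp add: minus_div_mult_eq_mod [symmetric])
  then have "circle_pt 1 (of_int p / real q) = circle_pt 1 (of_int (int p') / real q)"
    unfolding circle_pt_1_eq_iff[OF q] by blast
  then have "E = {f \<in> elements_of_order T q.
      \<exists>p\<in>{p'}. rotation_number r f = circle_pt 1 (of_int (int p) / real q)}"
    by (simp add: E_def)
  then show "finite (conjugacy_classes T E)" "card (conjugacy_classes T E) = card Sol"
    using conjugacy_classes_rotation_numbers[of "{p'}"] tot by simp_all
qed

end

theorem mainTheorem1:
  fixes r m q :: nat
  assumes "r \<ge> 1" and "m \<ge> 2" and "q \<ge> 2"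
  defines "T \<equiv> Brown_Thompson r m"
  shows
    "(\<not> gcd (m - 1) q dvd r \<longrightarrow>
        conjugacy_classes T (elements_of_order T q) = {}) \<and>
     (gcd (m - 1) q dvd r \<longrightarrow>
        (\<forall>p :: int. coprime p (int q) \<longrightarrow>
           finite (conjugacy_classes T
             {f \<in> elements_of_order T q.
                rotation_number r f = circle_pt 1 (of_int p / real q)}) \<and>
           card (conjugacy_classes T
             {f \<in> elements_of_order T q.
                rotation_number r f = circle_pt 1 (of_int p / real q)})
             = gcd (m - 1) q)) \<and>
     (gcd (m - 1) q dvd r \<longrightarrow>
        finite (conjugacy_classes T (elements_of_order T q)) \<and>
        card (conjugacy_classes T (elements_of_order T q)) = totient q * gcd (m - 1) q)"
proof -
  interpret brown_thompson_torsion m r q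
    using assms by unfold_locales
  \<comment> \<open>When the divisibility fails, \<open>card Sol\<close> is 0, and finiteness turns
    cardinality zero into emptiness.\<close>
  show ?thesis
    unfolding T_def
    using conjugacy_classes_order conjugacy_classes_rotation_number card_Sol by auto
qed

end
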